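(* Let $\mathcal{M}\subset\mathcal{B}(\mathfrak{H})$ be a finite-dimensional von Neumann algebra, and let $\mathcal{L}_\gamma=\mathcal{L}_A+\gamma\mathcal{L}_S$, $\gamma>0$, be quantum Markov semigroup generators on $\mathcal{M}$ such that $\exp(t\mathcal{L}_\gamma)$ is a second-order lift of $\exp(t\mathcal{L}_O)$ (in the sense defined in the context), with associated full-rank state $\sigma$. Let $C\ge 1$ and $\nu>0$ be constants such that $$\|e^{t\mathcal{L}_\gamma}X-E_{\mathcal{F}}(X)\|_{2,\sigma}\le Ce^{-\nu t}\|X-E_{\mathcal{F}}(X)\|_{2,\sigma}\qquad\text{for all }X\in\mathcal{M},\ t\ge0,$$ and let $t_{\rm rel}$ be the relaxation time of $\exp(t\mathcal{L}_\gamma)$. Then $$\nu\le(1+\log C)\sqrt{\tilde s_{\rm m}^{-1}\lambda_O},\qquad t_{\rm rel}\ge\frac{1}{2\sqrt{\tilde s_{\rm m}^{-1}\lambda_O}},$$ where $\tilde s_{\rm m}$ is the minimal nonzero eigenvalue of $\Pi_1(-\mathcal{L}_S)^{-1}\Pi_1$ and $\Pi_1$ is the orthogonal projection onto $\mathrm{Ran}(\mathcal{L}_AE_S)$ for the KMS inner product $\langle\cdot,\cdot\rangle_{\sigma,1/2}$.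
   Context: Notation. $\mathfrak{H}$ is a finite-dimensional Hilbert space and $\mathcal{M}\subset\mathcal{B}(\mathfrak{H})$ a von Neumann algebra. $\mathcal{D}_+(\mathcal{M})$ is the set of full-rank density operators in $\mathcal{M}$. A quantum Markov semigroup (QMS) on $\mathcal{M}$ is a semigroup $\exp(t\mathcal{L})$ of completely positive unital maps $\mathcal{M}\to\mathcal{M}$. $\Phi^\dag$ is the adjoint of $\Phi$ for the Hilbert–Schmidt inner product $\mathrm{tr}(X^*Y)$; $\sigma$ is invariant if $\mathcal{L}^\dag(\sigma)=0$. For $\sigma\in\mathcal{D}_+(\mathcal{M})$ the KMS inner product is $\langle X,Y\rangle_{\sigma,1/2}=\mathrm{tr}(\sigma^{1/2}X^*\sigma^{1/2}Y)$, with induced norm $\|\cdot\|_{2,\sigma}$; $\Phi^\star$ is the adjoint of $\Phi$ for this inner product; $\mathcal{L}$ is $\sigma$-KMS detailed balanced if $\mathcal{L}=\mathcal{L}^\star$. $\mathcal{F}(\mathcal{L})=\ker\mathcal{L}$ is the fixed-point algebra. Second-order lift. One is given a family $\mathcal{L}_\gamma=\mathcal{L}_A+\gamma\mathcal{L}_S$, each $\mathcal{L}_\gamma$ ($\gamma>0$) being a QMS generator on $\mathcal{M}$, with $\mathcal{L}_A,\mathcal{L}_S$ independent of $\gamma$. Let $E_S$, $E_{\mathcal{F}}$ be the conditional expectations with respect to $\sigma$ (equivalently the KMS-orthogonal projections) from $\mathcal{M}$ onto $\mathcal{F}(\mathcal{L}_S)$ and $\mathcal{F}(\mathcal{L}_\gamma)$.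 Under (A) below, $\sigma$ is invariant for all $\mathcal{L}_\gamma$ and for the QMS generator $\mathcal{L}_S$, and $\mathcal{F}(\mathcal{L}_\gamma)=\ker\mathcal{L}_A\cap\ker\mathcal{L}_S$ does not depend on $\gamma$. Set $\mathcal{L}_O:=-(\mathcal{L}_AE_S)^\star(-\mathcal{L}_S)^{-1}\mathcal{L}_AE_S$ on $\mathcal{F}(\mathcal{L}_S)$, where $(-\mathcal{L}_S)^{-1}$ is the pseudoinverse. $\exp(t\mathcal{L}_\gamma)$ is a second-order lift of $\exp(t\mathcal{L}_O)$ if: (A) for some $\sigma\in\mathcal{D}_+(\mathcal{M})$: $\mathcal{L}_S=\mathcal{L}_S^\star$ and $\mathcal{L}_A=-\mathcal{L}_A^\star$; (B) $\dim\mathcal{F}(\mathcal{L}_S)>\dim\mathcal{F}(\mathcal{L}_\gamma)$; (C) $E_S\mathcal{L}_AE_S=0$; (D) $\mathcal{L}_O$ generates a QMS on $\mathcal{F}(\mathcal{L}_S)$ that is $\sigma_o$-KMS detailed balanced for some full-rank invariant state $\sigma_o\in\mathcal{D}_+(\mathcal{F}(\mathcal{L}_S))$, with $\langle X,\mathcal{L}_OY\rangle_{\sigma,1/2}=\langle X,\mathcal{L}_OY\rangle_{\sigma_o,1/2}$ for all $X,Y\in\mathcal{F}(\mathcal{L}_S)$. Spectral gap: $\lambda_O:=\inf\frac{-\langle X,\mathcal{L}_OX\rangle_{\sigma,1/2}}{\|X-E_O(X)\|_{2,\sigma}^2}$, the infimum over $X\in\mathcal{F}(\mathcal{L}_S)$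 with $X\ne E_O(X)$, where $E_O$ is the conditional expectation from $\mathcal{M}$ onto $\mathcal{F}(\mathcal{L}_O)=\ker\mathcal{L}_O\subset\mathcal{F}(\mathcal{L}_S)$. Relaxation time: $t_{\rm rel}:=\inf\{t\ge0:\ \|e^{t\mathcal{L}_\gamma}X\|_{2,\sigma}\le e^{-1}\|X\|_{2,\sigma}\text{ for all }X\in\mathcal{M}\text{ with }E_{\mathcal{F}}(X)=0\}$. *)

theory Defs
  imports "HOL-Analysis.Analysis"
begin

section \<open>Complex matrices as operators\<close>

text \<open>The Hilbert space is \<open>complex ^ 'n\<close>, and \<open>complex ^ 'n ^ 'n\<close> is its algebra of
  operators.  Scalar multiplication in the library is real on this type, so the complex one is
  defined here.\<close>

type_synonym 'n cmat = "complex ^ 'n ^ 'n"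

definition cscale :: "complex \<Rightarrow> 'n cmat \<Rightarrow> 'n::finite cmat" where
  "cscale c X = map_matrix (\<lambda>z. c * z) X"

global_interpretation cmat: vector_space "cscale :: complex \<Rightarrow> 'n cmat \<Rightarrow> 'n::finite cmat"
  by unfold_locales (simp_all add: cscale_def vec_eq_iff algebra_simps)

definition adj :: "'n cmat \<Rightarrow> 'n::finite cmat" where
  "adj X = transpose (map_matrix cnj X)"

definition cip :: "complex ^ 'n \<Rightarrow> complex ^ 'n::finite \<Rightarrow> complex" where
  "cip u v = (\<Sum>i\<in>UNIV. cnj (u $ i) * v $ i)"

definition psd :: "'n::finite cmat \<Rightarrow> bool" where
  "psd X \<longleftrightarrow> (\<forall>v. cip v (X *v v) \<in> \<real>\<^sub>\<ge>\<^sub>0)"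

definition psd_sqrt :: "'n cmat \<Rightarrow> 'n::finite cmat" where
  "psd_sqrt X = (THE Y. psd Y \<and> Y ** Y = X)"

section \<open>Von Neumann algebras, states and inner products\<close>

definition commutant :: "'n cmat set \<Rightarrow> 'n::finite cmat set" where
  "commutant S = {X. \<forall>Y\<in>S. X ** Y = Y ** X}"

definition von_neumann_algebra :: "'n::finite cmat set \<Rightarrow> bool" where
  "von_neumann_algebra M \<longleftrightarrow> (\<forall>X\<in>M. adj X \<in> M) \<and> commutant (commutant M) = M"

text \<open>The set \<open>\<D>\<^sub>+(M)\<close> of full-rank density operators in \<open>M\<close>; the trace is that of the ambient
  matrix algebra.\<close>

definition full_rank_states :: "'n::finite cmat set \<Rightarrow> 'n cmat set" where
  "full_rank_states M = {\<rho>\<in>M. psd \<rho> \<and> trace \<rho> = 1 \<and> invertible \<rho>}"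

definition hs_ip :: "'n cmat \<Rightarrow> 'n::finite cmat \<Rightarrow> complex" where
  "hs_ip X Y = trace (adj X ** Y)"

definition kms_ip :: "'n cmat \<Rightarrow> 'n cmat \<Rightarrow> 'n::finite cmat \<Rightarrow> complex" where
  "kms_ip \<sigma> X Y = trace (psd_sqrt \<sigma> ** adj X ** psd_sqrt \<sigma> ** Y)"

definition kms_norm :: "'n cmat \<Rightarrow> 'n::finite cmat \<Rightarrow> real" where
  "kms_norm \<sigma> X = sqrt (Re (kms_ip \<sigma> X X))"

section \<open>Superoperators\<close>

text \<open>A superoperator on a subspace \<open>M\<close> of matrices is a function on all matrices of which only
  the values on \<open>M\<close> matter.\<close>

definition linear_map :: "'n cmat set \<Rightarrow> 'n cmat set \<Rightarrow> ('n cmat \<Rightarrow> 'n::finite cmat) \<Rightarrow> bool" where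
  "linear_map M N \<Phi> \<longleftrightarrow> (\<forall>X\<in>M. \<Phi> X \<in> N) \<and> (\<forall>X\<in>M. \<forall>Y\<in>M. \<Phi> (X + Y) = \<Phi> X + \<Phi> Y)
     \<and> (\<forall>c. \<forall>X\<in>M. \<Phi> (cscale c X) = cscale c (\<Phi> X))"

definition ker_on :: "'n cmat set \<Rightarrow> ('n cmat \<Rightarrow> 'n::finite cmat) \<Rightarrow> 'n cmat set" where
  "ker_on M \<Phi> = {X\<in>M. \<Phi> X = 0}"

text \<open>Adjoint of \<open>\<Phi> : M \<rightarrow> M\<close> for the inner product \<open>ip\<close> on \<open>M\<close>.\<close>

definition adjoint_for ::
  "('n cmat \<Rightarrow> 'n cmat \<Rightarrow> complex) \<Rightarrow> 'n cmat set \<Rightarrow> ('n cmat \<Rightarrow> 'n cmat) \<Rightarrow> 'n cmat \<Rightarrow> 'n::finite cmat"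
where
  "adjoint_for ip M \<Phi> Y = (THE Z. Z \<in> M \<and> (\<forall>X\<in>M. ip (\<Phi> X) Y = ip X Z))"

abbreviation hs_adjoint :: "'n cmat set \<Rightarrow> ('n cmat \<Rightarrow> 'n cmat) \<Rightarrow> 'n cmat \<Rightarrow> 'n::finite cmat" where
  "hs_adjoint \<equiv> adjoint_for hs_ip"

abbreviation kms_adjoint ::
  "'n cmat \<Rightarrow> 'n cmat set \<Rightarrow> ('n cmat \<Rightarrow> 'n cmat) \<Rightarrow> 'n cmat \<Rightarrow> 'n::finite cmat" where
  "kms_adjoint \<sigma> \<equiv> adjoint_for (kms_ip \<sigma>)"

definition kms_proj :: "'n cmat \<Rightarrow> 'n cmat set \<Rightarrow> 'n cmat \<Rightarrow> 'n::finite cmat" where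
  "kms_proj \<sigma> V X = (THE Y. Y \<in> V \<and> (\<forall>Z\<in>V. kms_ip \<sigma> Z (X - Y) = 0))"

text \<open>Moore--Penrose inverse of \<open>\<Phi> : M \<rightarrow> M\<close> for the KMS inner product: the preimage, orthogonal to
  the kernel of \<open>\<Phi>\<close>, of the orthogonal projection of \<open>Y\<close> onto the range of \<open>\<Phi>\<close>.\<close>

definition kms_pinv ::
  "'n cmat \<Rightarrow> 'n cmat set \<Rightarrow> ('n cmat \<Rightarrow> 'n cmat) \<Rightarrow> 'n cmat \<Rightarrow> 'n::finite cmat" where
  "kms_pinv \<sigma> M \<Phi> Y = (THE X. X \<in> M \<and> (\<forall>Z\<in>ker_on M \<Phi>. kms_ip \<sigma> Z X = 0)
     \<and> \<Phi> X = kms_proj \<sigma> (\<Phi> ` M) Y)"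

definition eigenvalue_on :: "'n cmat set \<Rightarrow> ('n cmat \<Rightarrow> 'n::finite cmat) \<Rightarrow> complex \<Rightarrow> bool" where
  "eigenvalue_on M \<Phi> \<mu> \<longleftrightarrow> (\<exists>X\<in>M. X \<noteq> 0 \<and> \<Phi> X = cscale \<mu> X)"

text \<open>Complete positivity on \<open>M\<close>: \<open>\<Phi>\<close> applied entrywise preserves positivity of \<open>m \<times> m\<close> block
  matrices with entries in \<open>M\<close>, acting on \<open>m\<close> copies of the Hilbert space, for every \<open>m\<close>.\<close>

definition block_psd :: "nat \<Rightarrow> (nat \<Rightarrow> nat \<Rightarrow> 'n::finite cmat) \<Rightarrow> bool" where
  "block_psd m B \<longleftrightarrow>
     (\<forall>v::nat \<Rightarrow> complex ^ 'n. (\<Sum>i<m. \<Sum>j<m. cip (v i) (B i j *v v j)) \<in> \<real>\<^sub>\<ge>\<^sub>0)"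

definition completely_positive :: "'n cmat set \<Rightarrow> ('n cmat \<Rightarrow> 'n::finite cmat) \<Rightarrow> bool" where
  "completely_positive M \<Phi> \<longleftrightarrow>
     (\<forall>m B. (\<forall>i<m. \<forall>j<m. B i j \<in> M) \<longrightarrow> block_psd m B \<longrightarrow> block_psd m (\<lambda>i j. \<Phi> (B i j)))"

text \<open>The conditional expectation from \<open>M\<close> onto \<open>N\<close> with respect to \<open>\<sigma>\<close>: the completely positive
  unital \<open>N\<close>-bimodule map preserving the state \<open>X \<mapsto> tr (\<sigma> X)\<close>.\<close>

definition conditional_expectation ::
  "'n cmat \<Rightarrow> 'n cmat set \<Rightarrow> 'n cmat set \<Rightarrow> ('n cmat \<Rightarrow> 'n::finite cmat) \<Rightarrow> bool" where
  "conditional_expectation \<sigma> M N E \<longleftrightarrow>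
     linear_map M N E \<and> (\<forall>X\<in>N. E X = X) \<and> completely_positive M E \<and> E (mat 1) = mat 1
     \<and> (\<forall>A\<in>N. \<forall>B\<in>N. \<forall>X\<in>M. E (A ** X ** B) = A ** E X ** B)
     \<and> (\<forall>X\<in>M. trace (\<sigma> ** E X) = trace (\<sigma> ** X))"

section \<open>Quantum Markov semigroups\<close>

definition sg_exp :: "('n cmat \<Rightarrow> 'n cmat) \<Rightarrow> real \<Rightarrow> 'n cmat \<Rightarrow> 'n::finite cmat" where
  "sg_exp L t X = (\<Sum>k. (t ^ k / fact k) *\<^sub>R (L ^^ k) X)"

definition qms_generator :: "'n cmat set \<Rightarrow> ('n cmat \<Rightarrow> 'n::finite cmat) \<Rightarrow> bool" where
  "qms_generator M L \<longleftrightarrow> linear_map M M L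
     \<and> (\<forall>t\<ge>0. completely_positive M (sg_exp L t) \<and> sg_exp L t (mat 1) = mat 1)"

definition kms_detailed_balanced ::
  "'n cmat \<Rightarrow> 'n cmat set \<Rightarrow> ('n cmat \<Rightarrow> 'n::finite cmat) \<Rightarrow> bool" where
  "kms_detailed_balanced \<sigma> M L \<longleftrightarrow> (\<forall>X\<in>M. L X = kms_adjoint \<sigma> M L X)"

definition invariant_state :: "'n cmat set \<Rightarrow> ('n cmat \<Rightarrow> 'n::finite cmat) \<Rightarrow> 'n cmat \<Rightarrow> bool" where
  "invariant_state M L \<sigma> \<longleftrightarrow> hs_adjoint M L \<sigma> = 0"

section \<open>Second-order lifts\<close>

definition lift_generator ::
  "('n cmat \<Rightarrow> 'n cmat) \<Rightarrow> ('n cmat \<Rightarrow> 'n cmat) \<Rightarrow> real \<Rightarrow> 'n cmat \<Rightarrow> 'n::finite cmat" where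
  "lift_generator LA LS \<gamma> X = LA X + \<gamma> *\<^sub>R LS X"

definition overdamped_generator ::
  "'n cmat \<Rightarrow> 'n cmat set \<Rightarrow> ('n cmat \<Rightarrow> 'n cmat) \<Rightarrow> ('n cmat \<Rightarrow> 'n cmat) \<Rightarrow> ('n cmat \<Rightarrow> 'n cmat)
   \<Rightarrow> 'n cmat \<Rightarrow> 'n::finite cmat" where
  "overdamped_generator \<sigma> M LA LS ES X =
     - kms_adjoint \<sigma> M (LA \<circ> ES) (kms_pinv \<sigma> M (\<lambda>Y. - LS Y) (LA (ES X)))"

definition second_order_lift ::
  "'n cmat \<Rightarrow> 'n cmat set \<Rightarrow> ('n cmat \<Rightarrow> 'n cmat) \<Rightarrow> ('n cmat \<Rightarrow> 'n cmat) \<Rightarrow> ('n cmat \<Rightarrow> 'n::finite cmat)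
   \<Rightarrow> bool" where
  "second_order_lift \<sigma> M LA LS ES \<longleftrightarrow>
     (let N = ker_on M LS; LO = overdamped_generator \<sigma> M LA LS ES in
       linear_map M M LA \<and> linear_map M M LS
     \<and> (\<forall>\<gamma>>0. qms_generator M (lift_generator LA LS \<gamma>))
     \<and> conditional_expectation \<sigma> M N ES
     \<and> (\<sigma> \<in> full_rank_states M
        \<and> (\<forall>X\<in>M. LS X = kms_adjoint \<sigma> M LS X) \<and> (\<forall>X\<in>M. LA X = - kms_adjoint \<sigma> M LA X))
     \<and> (\<forall>\<gamma>>0. cmat.dim (ker_on M (lift_generator LA LS \<gamma>)) < cmat.dim N)
     \<and> (\<forall>X\<in>M. ES (LA (ES X)) = 0)
     \<and> (qms_generator N LO
        \<and> (\<exists>\<sigma>o\<in>full_rank_states N. invariant_state N LO \<sigma>o \<and> kms_detailed_balanced \<sigma>o N LO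
             \<and> (\<forall>X\<in>N. \<forall>Y\<in>N. kms_ip \<sigma> X (LO Y) = kms_ip \<sigma>o X (LO Y)))))"

definition spectral_gap ::
  "'n cmat \<Rightarrow> 'n cmat set \<Rightarrow> ('n cmat \<Rightarrow> 'n cmat) \<Rightarrow> ('n cmat \<Rightarrow> 'n::finite cmat) \<Rightarrow> real" where
  "spectral_gap \<sigma> N L E =
     Inf {Re (- kms_ip \<sigma> X (L X)) / (kms_norm \<sigma> (X - E X))\<^sup>2 | X. X \<in> N \<and> X \<noteq> E X}"

definition relaxation_time ::
  "'n cmat \<Rightarrow> 'n cmat set \<Rightarrow> ('n cmat \<Rightarrow> 'n cmat) \<Rightarrow> ('n cmat \<Rightarrow> 'n::finite cmat) \<Rightarrow> real" where
  "relaxation_time \<sigma> M L E =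
     Inf {t. t \<ge> 0 \<and> (\<forall>X\<in>M. E X = 0 \<longrightarrow> kms_norm \<sigma> (sg_exp L t X) \<le> exp (- 1) * kms_norm \<sigma> X)}"

text \<open>The minimal nonzero eigenvalue of \<open>\<Pi>\<^sub>1 (- LS)\<^sup>-\<^sup>1 \<Pi>\<^sub>1\<close>.  This operator is self-adjoint for the KMS
  inner product, so its eigenvalues are real.\<close>

definition min_eigenvalue_compression ::
  "'n cmat \<Rightarrow> 'n cmat set \<Rightarrow> ('n cmat \<Rightarrow> 'n cmat) \<Rightarrow> ('n cmat \<Rightarrow> 'n cmat) \<Rightarrow> ('n cmat \<Rightarrow> 'n::finite cmat)
   \<Rightarrow> real" where
  "min_eigenvalue_compression \<sigma> M LA LS ES =
     (let P = kms_proj \<sigma> ((LA \<circ> ES) ` M) in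
       Min {r::real. r \<noteq> 0 \<and>
         eigenvalue_on M (P \<circ> kms_pinv \<sigma> M (\<lambda>Y. - LS Y) \<circ> P) (complex_of_real r)})"

end

theory Submission
  imports Defs
begin

text \<open>
  Write \<open>\<langle>X, Y\<rangle>\<close> for the KMS inner product, \<open>P\<^sub>t\<close> for the semigroup of \<open>L = LA + \<gamma> LS\<close>, \<open>N\<close> for the
  kernel of \<open>LS\<close> and \<open>F\<close> for that of \<open>L\<close>.  On \<open>N\<close> the lifted dynamics starts with the velocity
  \<open>L X = LA X\<close>, while the overdamped generator \<open>LO\<close> measures this velocity through
  \<open>\<langle>X, - LO X\<rangle> = \<langle>LA X, (- LS)\<^sup>-\<^sup>1 LA X\<rangle>\<close>.  Since \<open>ES LA ES = 0\<close>, the range of \<open>LA ES\<close> is orthogonal to \<open>N\<close>,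
  where \<open>(- LS)\<^sup>-\<^sup>1\<close> is positive definite; the right-hand side is therefore at least \<open>s \<parallel>LA X\<parallel>\<^sup>2\<close>, with \<open>s\<close>
  the minimal nonzero eigenvalue of the compression of \<open>(- LS)\<^sup>-\<^sup>1\<close> to that range
  (\<open>min_eigenvalue_compression\<close>).  Hence an observable \<open>Y \<in> N\<close> orthogonal to \<open>F\<close> whose Rayleigh
  quotient for \<open>- LO\<close> is \<open>q\<close> moves slowly: \<open>\<parallel>LA Y\<parallel> \<le> a \<parallel>Y\<parallel>\<close> with \<open>a\<^sup>2 = q / s\<close>
  (\<open>rayleigh_quotient_bound\<close>).

  A slow observable limits the decay in two ways, both read off from
  \<open>P\<^sub>t Y - Y = \<integral>\<^sub>0\<^sup>t P\<^sub>u LA Y du\<close>.  As \<open>P\<^sub>u\<close> is a contraction, \<open>\<parallel>P\<^sub>t Y\<parallel> \<ge> (1 - t a) \<parallel>Y\<parallel>\<close>; at a time \<open>t\<close> at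
  which all mean-zero observables have shrunk by the factor \<open>1/e \<le> 1/2\<close> this gives \<open>t \<ge> 1 / (2 a)\<close>.
  And letting \<open>t\<close> tend to infinity, \<open>\<parallel>Y\<parallel> \<le> \<integral>\<^sub>0\<^sup>\<infinity> min 1 (C e\<^sup>-\<^sup>\<nu>\<^sup>u) du \<parallel>LA Y\<parallel> = (1 + ln C) / \<nu> \<parallel>LA Y\<parallel>\<close>, so
  that \<open>\<nu> \<le> (1 + ln C) a\<close>.  Taking the infimum over \<open>q\<close> yields both bounds.

  Three facts carry this argument.  First, the KMS inner product is the Hilbert--Schmidt one
  transported by \<open>X \<mapsto> \<sigma>\<^sup>1\<^sup>/\<^sup>4 X \<sigma>\<^sup>1\<^sup>/\<^sup>4\<close> (\<open>Re_kms_ip\<close>), so that its real part is a Euclidean inner product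
  and adjoints, projections and extremal eigenvalues come from real linear algebra.  Second, a
  conditional expectation that preserves \<open>\<sigma>\<close> is a KMS-orthogonal projection
  (\<open>conditional_expectation_kms_orthogonal\<close>), because its range is invariant under the modular
  automorphism of \<open>\<sigma>\<close>.  Third, \<open>LS\<close> is negative semidefinite (\<open>symmetric_part_nonpos\<close>): positivity of
  the semigroups gives a minimum principle for \<open>LA + \<gamma> LS\<close>, which as \<open>\<gamma>\<close> tends to infinity becomes
  one for \<open>LS\<close> and excludes positive eigenvalues.
\<close>

section \<open>Symmetric operators on subspaces of Euclidean space\<close>

text \<open>Superoperators are constrained only on the algebra or on one of its subspaces; extending them
  to linear maps of the whole space makes their continuity and their exponential series available.\<close>

lemma linear_extension:
  fixes f :: "'a::euclidean_space \<Rightarrow> 'b::real_vector"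
  assumes V: "subspace V"
    and add: "\<And>x y. x \<in> V \<Longrightarrow> y \<in> V \<Longrightarrow> f (x + y) = f x + f y"
    and scale: "\<And>c x. x \<in> V \<Longrightarrow> f (c *\<^sub>R x) = c *\<^sub>R f x"
  obtains g where "linear g" "\<And>x. x \<in> V \<Longrightarrow> g x = f x"
proof -
  obtain B where B: "B \<subseteq> V" "independent B" "V \<subseteq> span B"
    using basis_exists by metis
  obtain g where g: "linear g" "\<And>x. x \<in> B \<Longrightarrow> g x = f x"
    using linear_independent_extend[OF B(2), of f] by auto
  have f0: "f 0 = 0"
    using scale[of 0 0] subspace_0[OF V] by simp
  have "subspace {x\<in>V. g x = f x}"
    using V g(1) f0 by (intro subspaceI)
      (auto simp: subspace_0 subspace_add subspace_scale linear_0 linear_add linear_scale assms)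
  then have "span B \<subseteq> {x\<in>V. g x = f x}"
    using B(1) g(2) by (intro span_minimal) auto
  then show ?thesis
    using B(3) g(1) that by blast
qed

lemma subspace_projection_exists:
  fixes J :: "'a::real_vector \<Rightarrow> 'b::euclidean_space"
  assumes J: "linear J" and V: "subspace V"
  obtains y where "y \<in> V" "\<And>z. z \<in> V \<Longrightarrow> J z \<bullet> J (x - y) = 0"
proof -
  have JV: "subspace (J ` V)"
    using J V by (rule linear_subspace_image)
  obtain u w where u: "u \<in> span (J ` V)" and w: "\<And>v. v \<in> span (J ` V) \<Longrightarrow> orthogonal w v"
    and eq: "J x = u + w"
    using orthogonal_subspace_decomp_exists[of "J ` V" "J x"] by metis
  obtain y where y: "y \<in> V" "u = J y"
    using u JV span_eq_iff[of "J ` V"] by blast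
  have "J z \<bullet> J (x - y) = 0" if "z \<in> V" for z
  proof -
    have "J (x - y) = w"
      using eq y(2) linear_diff[OF J, of x y] by simp
    moreover have "orthogonal w (J z)"
      using that by (intro w span_base) auto
    ultimately show ?thesis
      by (simp add: orthogonal_def inner_commute)
  qed
  then show ?thesis
    using that y(1) by blast
qed

text \<open>The first-order condition at a minimum of a quadratic function: a nonnegative quadratic
  polynomial that vanishes at \<open>0\<close> has no linear term.\<close>

lemma nonneg_quadratic_linear_coeff:
  fixes a b :: real
  assumes "\<And>t. 0 \<le> 2 * t * a + t\<^sup>2 * b"
  shows "a = 0"
proof (rule ccontr)
  assume a: "a \<noteq> 0"
  have b: "0 \<le> b"
    using assms[of 1] assms[of "-1"] by simp
  have "2 * (- a / (b + 1)) * a + (- a / (b + 1))\<^sup>2 * b = - (a\<^sup>2 * (b + 2)) / (b + 1)\<^sup>2"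
    using b by (simp add: divide_simps power2_eq_square) (simp add: algebra_simps)
  moreover have "a\<^sup>2 * (b + 2) / (b + 1)\<^sup>2 > 0"
    using a b by (intro divide_pos_pos mult_pos_pos) auto
  ultimately show False
    using assms[of "- a / (b + 1)"] by simp
qed

text \<open>The quadratic form of \<open>T\<close> attains its minimum on the unit sphere of \<open>V\<close> by compactness, and the
  first-order condition at a minimizer is the eigenvalue equation tested against \<open>V\<close>: the minimizer
  is an eigenvector of the compression of \<open>T\<close> to \<open>V\<close>.  Orthogonality refers to the inner product
  pulled back along \<open>J\<close>.\<close>

lemma rayleigh_minimizer:
  fixes J :: "'a::euclidean_space \<Rightarrow> 'b::euclidean_space"
  assumes J: "linear J" "inj J" and T: "linear T" and V: "subspace V" "V \<noteq> {0}"
    and sym: "\<And>x y. x \<in> V \<Longrightarrow> y \<in> V \<Longrightarrow> J (T x) \<bullet> J y = J x \<bullet> J (T y)"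
  obtains x r where "x \<in> V" "x \<noteq> 0" "\<And>y. y \<in> V \<Longrightarrow> J y \<bullet> J (T x) = r * (J y \<bullet> J x)"
    "\<And>y. y \<in> V \<Longrightarrow> r * (J y \<bullet> J y) \<le> J y \<bullet> J (T y)"
proof -
  define q where "q x = (J x \<bullet> J (T x)) / (J x \<bullet> J x)" for x
  define K where "K = V \<inter> sphere 0 1"
  have Jnz: "J x \<bullet> J x > 0" if "x \<noteq> 0" for x
    using that J by (auto simp: linear_injective_0)
  have cJ: "continuous_on A J" and cT: "continuous_on A T" for A
    using J(1) T by (auto intro: linear_continuous_on simp: linear_conv_bounded_linear)
  have cJT: "continuous_on A (\<lambda>x. J (T x))" for A
    using continuous_on_compose2[OF cJ[of UNIV] cT] by auto
  have nzK: "\<forall>x\<in>K. J x \<bullet> J x \<noteq> 0"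
  proof
    fix x assume "x \<in> K"
    then have "x \<noteq> 0" by (auto simp: K_def)
    then show "J x \<bullet> J x \<noteq> 0" using Jnz[of x] by linarith
  qed
  have "compact K"
    unfolding K_def using V(1) by (intro closed_Int_compact closed_subspace) auto
  moreover have "K \<noteq> {}"
  proof -
    obtain v where "v \<in> V" "v \<noteq> 0"
      using V subspace_0 by auto
    then have "(1 / norm v) *\<^sub>R v \<in> K"
      using V(1) by (simp add: K_def subspace_scale)
    then show ?thesis by blast
  qed
  moreover have "continuous_on K q"
    unfolding q_def
    by (intro continuous_intros cJ cJT) (use nzK in blast)
  ultimately obtain x where x: "x \<in> K" "\<And>y. y \<in> K \<Longrightarrow> q x \<le> q y"
    using continuous_attains_inf by metis
  define r where "r = q x"
  have xV: "x \<in> V" "x \<noteq> 0"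
    using x(1) by (auto simp: K_def)
  have low: "r * (J y \<bullet> J y) \<le> J y \<bullet> J (T y)" if "y \<in> V" for y
  proof (cases "y = 0")
    case True
    then show ?thesis using J T by (simp add: linear_0)
  next
    case False
    have "q ((1 / norm y) *\<^sub>R y) = q y"
      using False by (simp add: q_def linear_scale[OF J(1)] linear_scale[OF T])
    moreover have "(1 / norm y) *\<^sub>R y \<in> K"
      using False that V(1) by (simp add: K_def subspace_scale)
    ultimately have "r \<le> q y"
      using x(2) unfolding r_def by metis
    then show ?thesis
      using Jnz[OF False] by (simp add: q_def pos_le_divide_eq)
  qed
  have stat: "J y \<bullet> J (T x) = r * (J y \<bullet> J x)" if y: "y \<in> V" for y
  proof -
    define a where "a = J y \<bullet> J (T x) - r * (J y \<bullet> J x)"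
    define b where "b = J y \<bullet> J (T y) - r * (J y \<bullet> J y)"
    have x0: "J x \<bullet> J (T x) = r * (J x \<bullet> J x)"
      using Jnz[OF xV(2)] by (simp add: r_def q_def)
    have s: "J x \<bullet> J (T y) = J y \<bullet> J (T x)"
      using sym[OF xV(1) y] by (simp add: inner_commute)
    have "0 \<le> 2 * t * a + t\<^sup>2 * b" for t
    proof -
      have "r * (J (x + t *\<^sub>R y) \<bullet> J (x + t *\<^sub>R y)) \<le> J (x + t *\<^sub>R y) \<bullet> J (T (x + t *\<^sub>R y))"
        using xV(1) y V(1) by (intro low subspace_add subspace_scale)
      moreover have "J (x + t *\<^sub>R y) = J x + t *\<^sub>R J y" "J (T (x + t *\<^sub>R y)) = J (T x) + t *\<^sub>R J (T y)"
        using J(1) T by (simp_all add: linear_add linear_scale)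
      ultimately have "r * ((J x + t *\<^sub>R J y) \<bullet> (J x + t *\<^sub>R J y))
          \<le> (J x + t *\<^sub>R J y) \<bullet> (J (T x) + t *\<^sub>R J (T y))"
        by metis
      then have "r * (J x \<bullet> J x + t * (J x \<bullet> J y) + t * (J y \<bullet> J x + t * (J y \<bullet> J y)))
          \<le> J x \<bullet> J (T x) + t * (J x \<bullet> J (T y)) + t * (J y \<bullet> J (T x) + t * (J y \<bullet> J (T y)))"
        by (simp only: inner_add_left inner_add_right inner_scaleR_left inner_scaleR_right distrib_left add.assoc)
      then show ?thesis
        unfolding x0 s a_def b_def inner_commute[of "J x" "J y"]
        by (simp add: algebra_simps power2_eq_square)
    qed
    then have "a = 0"
      by (rule nonneg_quadratic_linear_coeff)
    then show ?thesis
      by (simp add: a_def)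
  qed
  show ?thesis
    using that xV stat low by blast
qed

text \<open>The orthogonal complement of the span of the eigenvectors is invariant, and unless it is zero a
  Rayleigh minimizer on it is one more eigenvector.\<close>

lemma symmetric_spanned_by_eigenvectors:
  fixes T :: "'a::euclidean_space \<Rightarrow> 'a"
  assumes T: "linear T" and V: "subspace V" and inv: "\<And>x. x \<in> V \<Longrightarrow> T x \<in> V"
    and sym: "\<And>x y. x \<in> V \<Longrightarrow> y \<in> V \<Longrightarrow> T x \<bullet> y = x \<bullet> T y"
  shows "V \<subseteq> span {x\<in>V. \<exists>r. T x = r *\<^sub>R x}"
proof
  fix x assume x: "x \<in> V"
  define E where "E = span {x\<in>V. \<exists>r. T x = r *\<^sub>R x}"
  have E: "subspace E" and EV: "E \<subseteq> V"
    unfolding E_def using V by (simp, intro span_minimal) auto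
  have TE: "T e \<in> E" if "e \<in> E" for e
  proof -
    have "subspace (T -` E)"
      using T E by (rule linear_subspace_vimage)
    moreover have "{x\<in>V. \<exists>r. T x = r *\<^sub>R x} \<subseteq> T -` E"
    proof
      fix x assume x: "x \<in> {x\<in>V. \<exists>r. T x = r *\<^sub>R x}"
      then obtain r where "T x = r *\<^sub>R x" by blast
      then show "x \<in> T -` E"
        using span_scale[OF span_base[OF x], of r] by (simp add: E_def)
    qed
    ultimately have "E \<subseteq> T -` E"
      unfolding E_def by (intro span_minimal)
    then show ?thesis using that by auto
  qed
  define U where "U = {u\<in>V. \<forall>e\<in>E. e \<bullet> u = 0}"
  have U: "subspace U"
    using V unfolding U_def subspace_def by (auto simp: inner_add_right)
  have "U = {0}"
  proof (rule ccontr)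
    assume "U \<noteq> {0}"
    moreover have "id (T x) \<bullet> id y = id x \<bullet> id (T y)" if "x \<in> U" "y \<in> U" for x y
      using that sym by (simp add: U_def)
    ultimately obtain u r where u: "u \<in> U" "u \<noteq> 0"
        "\<And>y. y \<in> U \<Longrightarrow> id y \<bullet> id (T u) = r * (id y \<bullet> id u)"
      using rayleigh_minimizer[OF linear_id inj_on_id T U] by metis
    have uV: "u \<in> V" and uE: "\<And>e. e \<in> E \<Longrightarrow> e \<bullet> u = 0"
      using u(1) by (auto simp: U_def)
    have "e \<bullet> T u = 0" if "e \<in> E" for e
      using sym[of e u] uV uE[OF TE[OF that]] that EV by auto
    moreover have "T u \<in> V"
      using uV by (rule inv)
    ultimately have "T u \<in> U"
      by (simp add: U_def)
    then have d: "T u - r *\<^sub>R u \<in> U"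
      using u(1) U by (simp add: subspace_diff subspace_scale)
    have "(T u - r *\<^sub>R u) \<bullet> (T u - r *\<^sub>R u) = 0"
      using u(3)[OF d] unfolding inner_diff_right[of "T u - r *\<^sub>R u"] by simp
    then have "u \<in> E"
      using u(1) unfolding E_def U_def by (auto intro!: span_base)
    then show False
      using u(1,2) by (auto simp: U_def)
  qed
  obtain y where y: "y \<in> E" "\<And>z. z \<in> E \<Longrightarrow> z \<bullet> (x - y) = 0"
    using subspace_projection_exists[OF linear_id E, of x] unfolding id_apply by metis
  have "x - y \<in> U"
    using x y EV V by (auto simp: U_def subspace_diff)
  then show "x \<in> span {x\<in>V. \<exists>r. T x = r *\<^sub>R x}"
    using \<open>U = {0}\<close> y(1) by (simp add: E_def)
qed

text \<open>A positive square root \<open>D\<close> of an operator is determined by the eigenvectors of that operator: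
  \<open>(D + \<surd>\<mu>) (D - \<surd>\<mu>) x = 0\<close>, and \<open>D + \<surd>\<mu>\<close> is injective unless \<open>\<mu> = 0\<close>.  This gives the uniqueness of
  square roots of matrices, and it shows that subspaces invariant under a positive operator are
  invariant under its square root.\<close>

lemma positive_root_on_eigenvector:
  fixes D :: "'a::euclidean_space \<Rightarrow> 'a"
  assumes D: "linear D" and sym: "\<And>x y. D x \<bullet> y = x \<bullet> D y" and pos: "\<And>x. 0 \<le> x \<bullet> D x"
    and eig: "D (D x) = \<mu> *\<^sub>R x"
  shows "D x = sqrt \<mu> *\<^sub>R x"
proof (cases "x = 0")
  case True
  then show ?thesis using D by (simp add: linear_0)
next
  case False
  have sq: "D x \<bullet> D x = \<mu> * (x \<bullet> x)"
    using sym[of x "D x"] eig by (simp)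
  then have "\<mu> * (x \<bullet> x) \<ge> 0"
    by (metis inner_ge_zero)
  moreover have "x \<bullet> x > 0"
    using False by simp
  ultimately have mu: "\<mu> \<ge> 0"
    by (simp add: zero_le_mult_iff)
  define y where "y = D x - sqrt \<mu> *\<^sub>R x"
  have "D y = - (sqrt \<mu> *\<^sub>R y)"
    using mu by (simp add: y_def linear_diff[OF D] linear_scale[OF D] eig algebra_simps)
  then have "sqrt \<mu> * (y \<bullet> y) \<le> 0"
    using pos[of y] by simp
  moreover have "sqrt \<mu> * (y \<bullet> y) \<ge> 0"
    using mu by simp
  ultimately have "sqrt \<mu> * (y \<bullet> y) = 0"
    by (rule antisym)
  then have "sqrt \<mu> = 0 \<or> y = 0"
    by simp
  then show ?thesis
    using sq by (auto simp: y_def)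
qed

section \<open>Self-adjoint matrices and positive square roots\<close>

text \<open>Eigenvectors of a symmetric operator for distinct eigenvalues are orthogonal, so this bounds the
  number of eigenvalues.\<close>

lemma orthogonal_family_finite:
  fixes J :: "'a \<Rightarrow> 'b::euclidean_space" and x :: "'i \<Rightarrow> 'a"
  assumes nz: "\<And>r. r \<in> R \<Longrightarrow> J (x r) \<noteq> 0"
    and orth: "\<And>r s. r \<in> R \<Longrightarrow> s \<in> R \<Longrightarrow> r \<noteq> s \<Longrightarrow> J (x r) \<bullet> J (x s) = 0"
  shows "finite R"
proof -
  have inj: "inj_on (\<lambda>r. J (x r)) R"
  proof (rule inj_onI, rule ccontr)
    fix r s assume "r \<in> R" "s \<in> R" "J (x r) = J (x s)" "r \<noteq> s"
    then show False using orth[of r s] nz[of s] by simp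
  qed
  have "pairwise orthogonal ((\<lambda>r. J (x r)) ` R)"
    using orth by (force simp: pairwise_def orthogonal_def)
  moreover have "0 \<notin> (\<lambda>r. J (x r)) ` R"
    using nz by force
  ultimately have "finite ((\<lambda>r. J (x r)) ` R)"
    by (intro independent_imp_finite pairwise_orthogonal_independent)
  then show ?thesis
    using inj by (rule finite_imageD)
qed

lemma adj_nth [simp]: "adj X $ i $ j = cnj (X $ j $ i)"
  by (simp add: adj_def transpose_def map_matrix_def)

lemma cscale_nth [simp]: "cscale c X $ i $ j = c * X $ i $ j"
  by (simp add: cscale_def)

lemma cmat_scaleR_nth: "(r *\<^sub>R X) $ i $ j = of_real r * X $ i $ j" for X :: "'n::finite cmat"
  by (simp add: scaleR_conv_of_real[of r "X $ i $ j"])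

lemma adj_adj [simp]: "adj (adj X) = X"
  by (simp add: vec_eq_iff)

lemma adj_add: "adj (X + Y) = adj X + adj Y"
  by (simp add: vec_eq_iff)

lemma adj_diff: "adj (X - Y) = adj X - adj Y"
  by (simp add: vec_eq_iff)

lemma adj_scaleR: "adj (r *\<^sub>R X) = r *\<^sub>R adj X"
  by (simp add: vec_eq_iff cmat_scaleR_nth del: vector_scaleR_component)

lemma adj_cscale: "adj (cscale c X) = cscale (cnj c) (adj X)"
  by (simp add: vec_eq_iff)

lemma adj_0 [simp]: "adj 0 = 0"
  by (simp add: vec_eq_iff)

lemma adj_mat_1 [simp]: "adj (mat 1) = mat 1"
  by (simp add: vec_eq_iff mat_def)

lemma adj_mult: "adj (X ** Y) = adj Y ** adj X"
  by (simp add: vec_eq_iff matrix_matrix_mult_def mult.commute)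

lemma cscale_of_real: "cscale (of_real r) X = r *\<^sub>R X"
  by (simp add: vec_eq_iff cmat_scaleR_nth del: vector_scaleR_component)

lemma cscale_mult_left: "cscale c X ** Y = cscale c (X ** Y)"
  by (simp add: vec_eq_iff matrix_matrix_mult_def sum_distrib_left mult_ac)

lemma cscale_mult_right: "X ** cscale c Y = cscale c (X ** Y)"
  by (simp add: vec_eq_iff matrix_matrix_mult_def sum_distrib_left mult_ac)

lemma trace_cscale: "trace (cscale c X) = c * trace X"
  by (simp add: trace_def sum_distrib_left)

lemma matrix_scaleR_mult_left: "(r *\<^sub>R X) ** Y = r *\<^sub>R (X ** Y)" for X Y :: "'n::finite cmat"
  by (simp flip: cscale_of_real add: cscale_mult_left)

lemma matrix_scaleR_mult_right: "X ** (r *\<^sub>R Y) = r *\<^sub>R (X ** Y)" for X Y :: "'n::finite cmat"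
  by (simp flip: cscale_of_real add: cscale_mult_right)

lemma cmat_add_rdistrib: "(X + Y) ** Z = X ** Z + Y ** Z" for X Y Z :: "'n::finite cmat"
  by (simp add: vec_eq_iff matrix_matrix_mult_def distrib_right sum.distrib)

lemma linear_sandwich: "linear (\<lambda>X. A ** X ** B)" for A B :: "'n::finite cmat"
  by (rule linearI)
    (simp_all add: matrix_add_ldistrib cmat_add_rdistrib matrix_scaleR_mult_left matrix_scaleR_mult_right)

lemma linear_mult_vec: "linear (\<lambda>v. X *v v)" for X :: "'n::finite cmat"
proof (rule linearI)
  show "X *v (r *\<^sub>R v) = r *\<^sub>R (X *v v)" for r v
    by (simp add: vec_eq_iff matrix_vector_mult_def scaleR_right.sum)
qed (rule matrix_vector_right_distrib)

lemma scaleR_mult_vec: "(r *\<^sub>R X) *v v = r *\<^sub>R (X *v v)" for X :: "'n::finite cmat"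
  by (simp add: vec_eq_iff matrix_vector_mult_def scaleR_right.sum)

lemma linear_mult_vec_left: "linear (\<lambda>X :: 'n::finite cmat. X *v v)"
  by (rule linearI) (simp_all only: matrix_vector_mult_add_rdistrib scaleR_mult_vec)

lemma matrix_eqI: "X = Y" if "\<And>v. X *v v = Y *v v" for X :: "'n::finite cmat"
  using that by (simp add: matrix_eq)

lemma inner_vec_eq_Re_cip: "u \<bullet> v = Re (cip u v)"
  by (simp add: inner_vec_def cip_def inner_complex_def)

lemma inner_cmat_eq_Re_hs_ip: "X \<bullet> Y = Re (hs_ip X Y)" for X :: "'n::finite cmat"
proof -
  have "hs_ip X Y = (\<Sum>i\<in>UNIV. \<Sum>k\<in>UNIV. cnj (X $ k $ i) * Y $ k $ i)"
    by (simp add: hs_ip_def trace_def matrix_matrix_mult_def)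
  also have "\<dots> = (\<Sum>k\<in>UNIV. \<Sum>i\<in>UNIV. cnj (X $ k $ i) * Y $ k $ i)"
    by (rule sum.swap)
  finally show ?thesis
    by (simp add: inner_vec_def inner_complex_def)
qed

lemma cip_add_left: "cip (u + w) v = cip u v + cip w v"
  by (simp add: cip_def algebra_simps sum.distrib)

lemma cip_add_right: "cip u (v + w) = cip u v + cip u w"
  by (simp add: cip_def algebra_simps sum.distrib)

lemma cip_scale_left: "cip (c *s u) v = cnj c * cip u v"
  by (simp add: cip_def sum_distrib_left mult_ac)

lemma cip_scale_right: "cip u (c *s v) = c * cip u v"
  by (simp add: cip_def sum_distrib_left mult_ac)

lemma cip_commute: "cip u v = cnj (cip v u)"
  by (simp add: cip_def mult.commute)

lemma cip_adj: "cip (adj X *v u) v = cip u (X *v v)"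
proof -
  have "cip (adj X *v u) v = (\<Sum>i\<in>UNIV. \<Sum>j\<in>UNIV. X $ j $ i * cnj (u $ j) * v $ i)"
    by (simp add: cip_def matrix_vector_mult_def sum_distrib_right)
  also have "\<dots> = (\<Sum>j\<in>UNIV. \<Sum>i\<in>UNIV. X $ j $ i * cnj (u $ j) * v $ i)"
    by (rule sum.swap)
  also have "\<dots> = cip u (X *v v)"
    by (simp add: cip_def matrix_vector_mult_def sum_distrib_left mult_ac)
  finally show ?thesis .
qed

text \<open>Polarization: in a complex space the quadratic form determines the operator.\<close>

lemma cmat_eq_0_if_quadratic_form_0:
  assumes "\<And>v. cip v (Z *v v) = 0"
  shows "Z = 0"
proof (rule matrix_eqI)
  fix w
  have z: "cip u (Z *v w) = 0" for u
  proof -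
    have "cip (u + w) (Z *v (u + w)) = 0" "cip (u + \<i> *s w) (Z *v (u + \<i> *s w)) = 0"
      by (rule assms)+
    moreover have "Z *v (\<i> *s w) = \<i> *s (Z *v w)"
      by (simp add: vector_scalar_commute)
    ultimately have *: "cip u (Z *v w) + cip w (Z *v u) = 0"
      "\<i> * cip u (Z *v w) - \<i> * cip w (Z *v u) = 0"
      using assms by (simp_all add: matrix_vector_right_distrib cip_add_left cip_add_right
          cip_scale_left cip_scale_right algebra_simps)
    have "cip w (Z *v u) = - cip u (Z *v w)"
      using *(1) by (simp only: add_eq_0_iff)
    with *(2) show ?thesis
      by simp
  qed
  have "(Z *v w) \<bullet> (Z *v w) = 0"
    unfolding inner_vec_eq_Re_cip by (simp add: z)
  then show "Z *v w = 0 *v w"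
    by simp
qed

lemma cip_adj_quadratic_form: "cip v (adj X *v v) = cnj (cip v (X *v v))"
  by (subst cip_commute) (simp only: cip_adj)

lemma adj_eq_self_iff_real_quadratic_form: "adj X = X \<longleftrightarrow> (\<forall>v. cip v (X *v v) \<in> \<real>)"
proof
  assume "adj X = X"
  then show "\<forall>v. cip v (X *v v) \<in> \<real>"
    by (metis cip_adj_quadratic_form Reals_cnj_iff)
next
  assume r: "\<forall>v. cip v (X *v v) \<in> \<real>"
  have "cip v ((adj X - X) *v v) = 0" for v
  proof -
    have "cip v (adj X *v v) = cnj (cip v (X *v v))"
      by (rule cip_adj_quadratic_form)
    also have "\<dots> = cip v (X *v v)"
      using r by (simp add: Reals_cnj_iff)
    finally show ?thesis
      by (simp add: matrix_vector_mult_diff_rdistrib cip_def right_diff_distrib sum_subtractf)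
  qed
  then show "adj X = X"
    using cmat_eq_0_if_quadratic_form_0[of "adj X - X"] by simp
qed

lemma inner_adj_mult_vec: "(adj X *v u) \<bullet> v = u \<bullet> (X *v v)"
  by (simp add: inner_vec_eq_Re_cip cip_adj)

text \<open>Positivity in terms of the real inner product; self-adjointness is what the complex
  definition of positivity implies beyond nonnegativity of the real part.\<close>

lemma psd_iff: "psd X \<longleftrightarrow> adj X = X \<and> (\<forall>v. 0 \<le> v \<bullet> (X *v v))"
  unfolding psd_def adj_eq_self_iff_real_quadratic_form inner_vec_eq_Re_cip
  by (auto simp: complex_is_Real_iff complex_nonneg_Reals_iff)

lemma psd_adj: "psd X \<Longrightarrow> adj X = X"
  by (simp add: psd_iff)

lemma hermitian_span_eigenvectors:
  fixes X :: "'n::finite cmat"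
  assumes "adj X = X"
  shows "span {v. \<exists>r. X *v v = r *\<^sub>R v} = UNIV"
  using symmetric_spanned_by_eigenvectors[OF linear_mult_vec[of X], of UNIV]
    inner_adj_mult_vec[of X] assms by auto

lemma cmat_eq_if_eq_on_eigenvectors:
  fixes X Y Z :: "'n::finite cmat"
  assumes X: "adj X = X" and eq: "\<And>v r. X *v v = r *\<^sub>R v \<Longrightarrow> Y *v v = Z *v v"
  shows "Y = Z"
proof (rule matrix_eqI)
  fix v
  have "v \<in> span {v. \<exists>r. X *v v = r *\<^sub>R v}"
    using hermitian_span_eigenvectors[OF X] by simp
  then show "Y *v v = Z *v v"
    by (rule linear_eq_on[OF linear_mult_vec linear_mult_vec]) (use eq in auto)
qed

lemma hermitian_eigenvectors_orthogonal:
  fixes X :: "'n::finite cmat"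
  assumes "adj X = X" "X *v u = r *\<^sub>R u" "X *v v = s *\<^sub>R v" "r \<noteq> s"
  shows "u \<bullet> v = 0"
  using inner_adj_mult_vec[of X u v] assms by (simp)

text \<open>The matrix \<open>f(X)\<close> is a combination of the spectral projections of \<open>X\<close>, which are the Lagrange
  interpolation polynomials of the eigenvalues evaluated at \<open>X\<close>.\<close>

lemma hermitian_functional_calculus:
  fixes X :: "'n::finite cmat" and f :: "real \<Rightarrow> real"
  assumes X: "adj X = X"
  obtains Y where "adj Y = Y" "\<And>v r. X *v v = r *\<^sub>R v \<Longrightarrow> Y *v v = f r *\<^sub>R v"
proof -
  define R where "R = {r. \<exists>v. v \<noteq> 0 \<and> X *v v = r *\<^sub>R v}"
  have "\<forall>r\<in>R. \<exists>v. v \<noteq> 0 \<and> X *v v = r *\<^sub>R v"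
    by (simp add: R_def)
  then obtain x where x: "\<And>r. r \<in> R \<Longrightarrow> x r \<noteq> 0 \<and> X *v x r = r *\<^sub>R x r"
    by metis
  have fin: "finite R"
    using x hermitian_eigenvectors_orthogonal[OF X]
    by (intro orthogonal_family_finite[of R id x]) auto
  have sel: "\<exists>Q::'n cmat. (\<forall>r\<in>A. \<forall>v. X *v v = r *\<^sub>R v \<longrightarrow> Q *v v = 0) \<and> (\<forall>v. X *v v = a *\<^sub>R v \<longrightarrow> Q *v v = v)"
    if "finite A" "a \<notin> A" for A a
    using that
  proof (induction A rule: finite_induct)
    case empty
    show ?case by (intro exI[of _ "mat 1"]) simp
  next
    case (insert b A)
    then obtain Q :: "'n cmat" where Q: "\<And>r v. r \<in> A \<Longrightarrow> X *v v = r *\<^sub>R v \<Longrightarrow> Q *v v = 0"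
      "\<And>v. X *v v = a *\<^sub>R v \<Longrightarrow> Q *v v = v" by auto
    \<comment> \<open>one more interpolation factor: it is \<open>0\<close> on the eigenspace of \<open>b\<close> and \<open>1\<close> on that of \<open>a\<close>\<close>
    define Q' where "Q' = (1 / (a - b)) *\<^sub>R (Q ** (X - b *\<^sub>R mat 1))"
    have act: "Q' *v v = ((r - b) / (a - b)) *\<^sub>R (Q *v v)" if "X *v v = r *\<^sub>R v" for r v
      unfolding Q'_def scaleR_mult_vec
      by (simp flip: matrix_vector_mul_assoc scaleR_diff_left
          add: matrix_vector_mult_diff_rdistrib scaleR_mult_vec that linear_scale[OF linear_mult_vec])
    show ?case
    proof (intro exI[of _ Q'] conjI ballI allI impI)
      fix r v assume "r \<in> insert b A" "X *v v = r *\<^sub>R v"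
      then show "Q' *v v = 0"
        using act[of v r] Q(1)[of r v] by (cases "r = b") simp_all
    next
      fix v assume "X *v v = a *\<^sub>R v"
      then show "Q' *v v = v"
        using act[of v a] Q(2)[of v] insert.prems by simp
    qed
  qed
  then have "\<forall>a\<in>R. \<exists>Q::'n cmat. (\<forall>r\<in>R - {a}. \<forall>v. X *v v = r *\<^sub>R v \<longrightarrow> Q *v v = 0) \<and> (\<forall>v. X *v v = a *\<^sub>R v \<longrightarrow> Q *v v = v)"
    using fin by auto
  then obtain Q :: "real \<Rightarrow> 'n cmat" where
    Q: "\<And>a r v. a \<in> R \<Longrightarrow> r \<in> R \<Longrightarrow> r \<noteq> a \<Longrightarrow> X *v v = r *\<^sub>R v \<Longrightarrow> Q a *v v = 0"
       "\<And>a v. a \<in> R \<Longrightarrow> X *v v = a *\<^sub>R v \<Longrightarrow> Q a *v v = v"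
    by (metis Diff_iff singletonD)
  define Y where "Y = (\<Sum>a\<in>R. f a *\<^sub>R Q a)"
  have act: "Y *v v = f r *\<^sub>R v" if v: "X *v v = r *\<^sub>R v" for v r
  proof (cases "v = 0")
    case False
    then have r: "r \<in> R"
      using v by (auto simp: R_def)
    have "Y *v v = (\<Sum>a\<in>R. f a *\<^sub>R (Q a *v v))"
      unfolding Y_def linear_sum[OF linear_mult_vec_left] by (simp add: scaleR_mult_vec)
    also have "\<dots> = (\<Sum>a\<in>R. if a = r then f r *\<^sub>R v else 0)"
      using r v by (intro sum.cong) (auto simp: Q)
    finally show ?thesis
      using r fin by simp
  qed simp
  have "(Y *v u) \<bullet> v = u \<bullet> (Y *v v)" for u v
  proof -
    let ?E = "{v. \<exists>r. X *v v = r *\<^sub>R v}"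
    have base: "(Y *v u) \<bullet> v = u \<bullet> (Y *v v)" if uv: "u \<in> ?E" "v \<in> ?E" for u v
    proof -
      obtain r s where e: "X *v u = r *\<^sub>R u" "X *v v = s *\<^sub>R v"
        using uv by blast
      then show ?thesis
        using hermitian_eigenvectors_orthogonal[OF X e] act[OF e(1)] act[OF e(2)] by (cases "r = s") simp_all
    qed
    have bil: "bilinear (\<lambda>u v. (Y *v u) \<bullet> v)" "bilinear (\<lambda>u v. u \<bullet> (Y *v v))"
      by (auto simp: bilinear_def intro!: linearI
          simp: linear_add[OF linear_mult_vec] linear_scale[OF linear_mult_vec] inner_simps)
    have span: "UNIV \<subseteq> span ?E"
      using hermitian_span_eigenvectors[OF X] by simp
    show ?thesis
      using bilinear_eq[OF bil span span UNIV_I UNIV_I base] .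
  qed
  then have "u \<bullet> (adj Y *v v) = u \<bullet> (Y *v v)" for u v
    by (metis inner_adj_mult_vec inner_commute)
  then have "adj Y = Y"
    by (intro matrix_eqI) (metis vector_eq_ldot)
  then show ?thesis
    using act that by blast
qed

lemma hermitian_square_psd: "psd (A ** A)" if "adj A = A"
  using that inner_adj_mult_vec[of A]
  by (simp add: psd_iff adj_mult flip: matrix_vector_mul_assoc) (metis inner_ge_zero)

lemma psd_root_on_eigenvector:
  assumes "psd Y" "(Y ** Y) *v v = r *\<^sub>R v"
  shows "Y *v v = sqrt r *\<^sub>R v"
  using assms inner_adj_mult_vec[of Y]
  by (intro positive_root_on_eigenvector[OF linear_mult_vec]) (auto simp: psd_iff simp flip: matrix_vector_mul_assoc)

text \<open>Existence comes from the square of a self-adjoint fourth root, for which positivity is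
  immediate; on eigenvectors two positive roots agree, which gives uniqueness.\<close>

lemma psd_sqrt:
  assumes X: "psd X"
  shows "psd (psd_sqrt X)" "psd_sqrt X ** psd_sqrt X = X"
proof -
  have "\<exists>!Y. psd Y \<and> Y ** Y = X"
  proof (rule ex_ex1I)
    obtain A where A: "adj A = A" "\<And>v r. X *v v = r *\<^sub>R v \<Longrightarrow> A *v v = sqrt (sqrt r) *\<^sub>R v"
      using hermitian_functional_calculus[OF psd_adj[OF X], of "\<lambda>r. sqrt (sqrt r)"] by metis
    have "(A ** A) ** (A ** A) = X"
    proof (rule cmat_eq_if_eq_on_eigenvectors[OF psd_adj[OF X]])
      fix v r assume v: "X *v v = r *\<^sub>R v"
      have pos: "v = 0 \<or> r \<ge> 0"
      proof -
        have "0 \<le> r * (v \<bullet> v)"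
          using X v unfolding psd_iff by (metis inner_scaleR_right)
        then show ?thesis
          using mult_neg_pos[of r "v \<bullet> v"] inner_gt_zero_iff[of v] by linarith
      qed
      then show "((A ** A) ** (A ** A)) *v v = X *v v"
        by (auto simp flip: matrix_vector_mul_assoc simp: A(2)[OF v] v linear_scale[OF linear_mult_vec])
    qed
    then show "\<exists>Y. psd Y \<and> Y ** Y = X"
      using hermitian_square_psd[OF A(1)] by blast
  next
    fix Y Z assume "psd Y \<and> Y ** Y = X" "psd Z \<and> Z ** Z = X"
    then show "Y = Z"
      using psd_root_on_eigenvector[of Y] psd_root_on_eigenvector[of Z]
      by (intro cmat_eq_if_eq_on_eigenvectors[OF psd_adj[OF X]]) presburger
  qed
  from theI'[OF this] show "psd (psd_sqrt X)" "psd_sqrt X ** psd_sqrt X = X"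
    by (auto simp: psd_sqrt_def)
qed

section \<open>The KMS inner product as a Euclidean inner product\<close>

lemma cmat_diff_rdistrib: "(Y - Z) ** X = Y ** X - Z ** X" for X Y Z :: "'n::finite cmat"
  by (simp add: vec_eq_iff matrix_matrix_mult_def left_diff_distrib sum_subtractf)

lemma invertible_cmatE:
  fixes X :: "'n::finite cmat"
  assumes "invertible X"
  obtains Y where "X ** Y = mat 1" "Y ** X = mat 1"
  using assms unfolding invertible_def by blast

lemma cmat_diff_ldistrib: "X ** (Y - Z) = X ** Y - X ** Z" for X Y Z :: "'n::finite cmat"
  by (simp add: vec_eq_iff matrix_matrix_mult_def right_diff_distrib sum_subtractf)

lemma inverse_of_hermitian:
  fixes R U :: "'n::finite cmat"
  assumes "adj R = R" "R ** U = mat 1" "U ** R = mat 1"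
  shows "adj U = U"
proof -
  have "adj U ** R = mat 1"
    using arg_cong[OF assms(2), of adj] assms(1) by (simp add: adj_mult)
  then have "(adj U ** R) ** U = U"
    by simp
  then show ?thesis
    using assms(2) by (simp flip: matrix_mul_assoc)
qed

lemma complex_subspace_imp_subspace:
  assumes "cmat.subspace V"
  shows "subspace V"
  using assms unfolding cmat.subspace_def
  by (intro subspaceI) (auto simp flip: cscale_of_real)

lemma linear_mapD:
  assumes "linear_map M N \<Phi>"
  shows "\<And>X. X \<in> M \<Longrightarrow> \<Phi> X \<in> N" "\<And>X Y. X \<in> M \<Longrightarrow> Y \<in> M \<Longrightarrow> \<Phi> (X + Y) = \<Phi> X + \<Phi> Y"
    "\<And>c X. X \<in> M \<Longrightarrow> \<Phi> (cscale c X) = cscale c (\<Phi> X)"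
    "\<And>r X. X \<in> M \<Longrightarrow> \<Phi> (r *\<^sub>R X) = r *\<^sub>R \<Phi> X"
  using assms unfolding linear_map_def by (auto simp flip: cscale_of_real)

lemma linear_map_extension:
  assumes "cmat.subspace M" "linear_map M N \<Phi>"
  obtains g where "linear g" "\<And>X. X \<in> M \<Longrightarrow> g X = \<Phi> X"
  using linear_extension[of M \<Phi>] assms complex_subspace_imp_subspace linear_mapD[OF assms(2)] by metis

text \<open>The map \<open>X \<mapsto> \<sigma>\<^sup>1\<^sup>/\<^sup>4 X \<sigma>\<^sup>1\<^sup>/\<^sup>4\<close>, an isometry from the KMS inner product to the Hilbert--Schmidt one.\<close>

definition kms_root :: "'n cmat \<Rightarrow> 'n cmat \<Rightarrow> 'n::finite cmat" where
  "kms_root \<sigma> X = psd_sqrt (psd_sqrt \<sigma>) ** X ** psd_sqrt (psd_sqrt \<sigma>)"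

lemma kms_ip_cscale_left: "kms_ip \<sigma> (cscale c X) Y = cnj c * kms_ip \<sigma> X Y"
  by (simp add: kms_ip_def adj_cscale cscale_mult_left cscale_mult_right trace_cscale)

lemma kms_ip_diff_right: "kms_ip \<sigma> X (Y - Z) = kms_ip \<sigma> X Y - kms_ip \<sigma> X Z"
  by (simp add: kms_ip_def cmat_diff_ldistrib trace_sub)

lemma hermitian_sandwich_symmetric:
  fixes P Q A B :: "'n::finite cmat"
  assumes "adj P = P" "adj Q = Q"
  shows "(P ** A ** Q) \<bullet> B = A \<bullet> (P ** B ** Q)"
proof -
  have "trace (adj (P ** A ** Q) ** B) = trace (Q ** (adj A ** P ** B))"
    using assms by (simp add: adj_mult matrix_mul_assoc)
  also have "\<dots> = trace (adj A ** (P ** B ** Q))"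
    by (subst trace_mul_sym) (simp add: matrix_mul_assoc)
  finally show ?thesis
    by (simp add: inner_cmat_eq_Re_hs_ip hs_ip_def)
qed

locale faithful_state =
  fixes \<sigma> :: "'n::finite cmat"
  assumes psd: "psd \<sigma>" and inv: "invertible \<sigma>"
begin

abbreviation "J \<equiv> kms_root \<sigma>"
abbreviation "S \<equiv> psd_sqrt \<sigma>"
abbreviation "R \<equiv> psd_sqrt (psd_sqrt \<sigma>)"

lemma psd_S: "psd S" and SS: "S ** S = \<sigma>" and psd_R: "psd R" and RR: "R ** R = S"
  using psd_sqrt psd by blast+

lemma adj_S: "adj S = S" and adj_R: "adj R = R" and adj_sigma: "adj \<sigma> = \<sigma>"
  using psd_S psd_R psd psd_adj by blast+

text \<open>The matrix \<open>\<sigma>\<^sup>-\<^sup>1\<^sup>/\<^sup>4\<close>.\<close>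

definition U where "U = (SOME U. R ** U = mat 1 \<and> U ** R = mat 1)"

lemma RU: "R ** U = mat 1" and UR: "U ** R = mat 1"
proof -
  obtain Y where Y: "\<sigma> ** Y = mat 1" "Y ** \<sigma> = mat 1"
    using inv invertible_cmatE by blast
  then have "R ** (R ** S ** Y) = mat 1"
    by (metis SS RR matrix_mul_assoc)
  then have "\<exists>U. R ** U = mat 1 \<and> U ** R = mat 1"
    using matrix_left_right_inverse by blast
  then have "R ** U = mat 1 \<and> U ** R = mat 1"
    unfolding U_def by (rule someI_ex)
  then show "R ** U = mat 1" "U ** R = mat 1"
    by auto
qed

lemma adj_U: "adj U = U"
  using inverse_of_hermitian adj_R RU UR by blast

lemma linear_J: "linear J"
  using linear_sandwich[of R R] by (simp add: kms_root_def[abs_def])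

lemma J_inverse: "U ** J X ** U = X"
proof -
  have "U ** J X ** U = (U ** R) ** X ** (R ** U)"
    by (simp add: kms_root_def matrix_mul_assoc)
  then show ?thesis
    by (simp add: RU UR)
qed

lemma inj_J: "inj J"
  by (metis J_inverse injI)

lemma J_eq_0 [simp]: "J X = 0 \<longleftrightarrow> X = 0"
  using linear_injective_0[OF linear_J] inj_J linear_0[OF linear_J] by blast

lemma Re_kms_ip: "Re (kms_ip \<sigma> X Y) = J X \<bullet> J Y"
proof -
  have "(R ** R) ** adj X ** (R ** R) ** Y = R ** (R ** adj X ** R ** R ** Y)"
    by (simp only: matrix_mul_assoc)
  then have "trace (S ** adj X ** S ** Y) = trace (R ** (R ** adj X ** R ** R ** Y))"
    by (simp only: RR)
  also have "\<dots> = trace (adj (J X) ** J Y)"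
    by (subst trace_mul_sym) (simp add: kms_root_def adj_mult adj_R matrix_mul_assoc)
  finally show ?thesis
    by (simp add: kms_ip_def inner_cmat_eq_Re_hs_ip hs_ip_def)
qed

lemma kms_norm_eq: "kms_norm \<sigma> X = norm (J X)"
  by (simp add: kms_norm_def Re_kms_ip norm_eq_sqrt_inner)

text \<open>On a complex subspace orthogonality can be tested with the real part alone, because replacing
  \<open>Z\<close> by \<open>\<i> Z\<close> turns the imaginary part into a real part.\<close>

lemma kms_ip_eq_0I:
  assumes V: "cmat.subspace V" and orth: "\<And>Z. Z \<in> V \<Longrightarrow> J Z \<bullet> J W = 0" and Z: "Z \<in> V"
  shows "kms_ip \<sigma> Z W = 0"
proof -
  have "Re (kms_ip \<sigma> Z W) = 0" "Re (kms_ip \<sigma> (cscale \<i> Z) W) = 0"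
    using orth Z V by (simp_all add: Re_kms_ip cmat.subspace_scale)
  then show ?thesis
    by (simp add: kms_ip_cscale_left complex_eq_iff)
qed

lemma J_eqI:
  assumes V: "subspace V" and "x \<in> V" "y \<in> V" and "\<And>z. z \<in> V \<Longrightarrow> J z \<bullet> J (x - y) = 0"
  shows "x = y"
proof -
  have "J (x - y) \<bullet> J (x - y) = 0"
    using assms by (simp add: subspace_diff)
  then show ?thesis
    by simp
qed

lemma kms_proj_eqI:
  assumes V: "cmat.subspace V" and Y: "Y \<in> V" and orth: "\<And>Z. Z \<in> V \<Longrightarrow> J Z \<bullet> J (X - Y) = 0"
  shows "kms_proj \<sigma> V X = Y"
  unfolding kms_proj_def
proof (rule the_equality)
  show "Y \<in> V \<and> (\<forall>Z\<in>V. kms_ip \<sigma> Z (X - Y) = 0)"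
    using kms_ip_eq_0I[OF V orth] Y by blast
next
  fix Y' assume Y': "Y' \<in> V \<and> (\<forall>Z\<in>V. kms_ip \<sigma> Z (X - Y') = 0)"
  have "J Z \<bullet> J (Y' - Y) = 0" if "Z \<in> V" for Z
  proof -
    have "J Z \<bullet> J (X - Y') = 0"
      using Y' that by (simp flip: Re_kms_ip)
    then show ?thesis
      using orth[OF that] by (simp add: linear_diff[OF linear_J] inner_diff_right)
  qed
  then show "Y' = Y"
    using Y Y' complex_subspace_imp_subspace[OF V] by (intro J_eqI) auto
qed

lemma kms_proj:
  assumes V: "cmat.subspace V"
  shows "kms_proj \<sigma> V X \<in> V" "Z \<in> V \<Longrightarrow> J Z \<bullet> J (X - kms_proj \<sigma> V X) = 0"
proof -
  obtain Y where Y: "Y \<in> V" "\<And>Z. Z \<in> V \<Longrightarrow> J Z \<bullet> J (X - Y) = 0"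
    using subspace_projection_exists[OF linear_J complex_subspace_imp_subspace[OF V]] by blast
  then show "kms_proj \<sigma> V X \<in> V" "Z \<in> V \<Longrightarrow> J Z \<bullet> J (X - kms_proj \<sigma> V X) = 0"
    using kms_proj_eqI[OF V Y] by auto
qed

lemma kms_proj_ident: "cmat.subspace V \<Longrightarrow> X \<in> V \<Longrightarrow> kms_proj \<sigma> V X = X"
  by (rule kms_proj_eqI) (auto simp: linear_0[OF linear_J])

text \<open>Existence by the Riesz representation of the functional \<open>X \<mapsto> \<langle>\<Phi> X, Y\<rangle>\<close>, whose representing vector
  is then projected to \<open>M\<close>; complex linearity of \<open>\<Phi>\<close> upgrades the real identity to the complex one.\<close>

lemma kms_adjoint:
  assumes M: "cmat.subspace M" and \<Phi>: "linear_map M M \<Phi>"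
  shows "kms_adjoint \<sigma> M \<Phi> Y \<in> M"
    and "X \<in> M \<Longrightarrow> J (\<Phi> X) \<bullet> J Y = J X \<bullet> J (kms_adjoint \<sigma> M \<Phi> Y)"
proof -
  obtain g where g: "linear g" "\<And>X. X \<in> M \<Longrightarrow> g X = \<Phi> X"
    using linear_map_extension[OF M \<Phi>] by blast
  define h where "h A = J (g (U ** A ** U))" for A
  have h: "linear h"
    using linear_compose[OF linear_compose[OF linear_sandwich[of U U] g(1)] linear_J]
    by (simp add: h_def[abs_def] o_def)
  define Z0 where "Z0 = U ** adjoint h (J Y) ** U"
  have JZ0: "J Z0 = adjoint h (J Y)"
  proof -
    have "J Z0 = (R ** U) ** adjoint h (J Y) ** (U ** R)"
      by (simp add: Z0_def kms_root_def matrix_mul_assoc)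
    then show ?thesis by (simp add: RU UR)
  qed
  define Z where "Z = kms_proj \<sigma> M Z0"
  have Z: "Z \<in> M"
    unfolding Z_def using M by (rule kms_proj)
  have real: "J (\<Phi> X) \<bullet> J Y = J X \<bullet> J Z" if X: "X \<in> M" for X
  proof -
    have "J X \<bullet> J Z = J X \<bullet> J Z0"
      using kms_proj(2)[OF M X, of Z0] by (simp add: Z_def linear_diff[OF linear_J] inner_diff_right)
    also have "\<dots> = h (J X) \<bullet> J Y"
      unfolding JZ0 using h by (rule adjoint_works)
    also have "\<dots> = J (\<Phi> X) \<bullet> J Y"
      by (simp add: h_def J_inverse g(2)[OF X])
    finally show ?thesis by simp
  qed
  have cplx: "kms_ip \<sigma> (\<Phi> X) Y = kms_ip \<sigma> X Z" if X: "X \<in> M" for X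
  proof -
    have "Re (kms_ip \<sigma> (\<Phi> X) Y) = Re (kms_ip \<sigma> X Z)"
      using real[OF X] by (simp add: Re_kms_ip)
    moreover have "Re (kms_ip \<sigma> (\<Phi> (cscale \<i> X)) Y) = Re (kms_ip \<sigma> (cscale \<i> X) Z)"
      using real[of "cscale \<i> X"] X M by (simp add: Re_kms_ip cmat.subspace_scale)
    ultimately show ?thesis
      by (simp add: linear_mapD(3)[OF \<Phi> X] kms_ip_cscale_left complex_eq_iff)
  qed
  have "kms_adjoint \<sigma> M \<Phi> Y = Z"
    unfolding adjoint_for_def
  proof (rule the_equality)
    show "Z \<in> M \<and> (\<forall>X\<in>M. kms_ip \<sigma> (\<Phi> X) Y = kms_ip \<sigma> X Z)"
      using Z cplx by blast
  next
    fix Z' assume Z': "Z' \<in> M \<and> (\<forall>X\<in>M. kms_ip \<sigma> (\<Phi> X) Y = kms_ip \<sigma> X Z')"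
    then have "J X \<bullet> J (Z' - Z) = 0" if "X \<in> M" for X
      using cplx that by (simp add: kms_ip_diff_right flip: Re_kms_ip)
    then show "Z' = Z"
      using Z Z' complex_subspace_imp_subspace[OF M] by (intro J_eqI) auto
  qed
  then show "kms_adjoint \<sigma> M \<Phi> Y \<in> M" "X \<in> M \<Longrightarrow> J (\<Phi> X) \<bullet> J Y = J X \<bullet> J (kms_adjoint \<sigma> M \<Phi> Y)"
    using Z real by auto
qed

end

section \<open>Conditional expectations are KMS-orthogonal projections\<close>

lemma commutant_closed:
  fixes T :: "'n::finite cmat set"
  shows "mat 1 \<in> commutant T"
    and "X \<in> commutant T \<Longrightarrow> Y \<in> commutant T \<Longrightarrow> X + Y \<in> commutant T"
    and "X \<in> commutant T \<Longrightarrow> cscale c X \<in> commutant T"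
    and "X \<in> commutant T \<Longrightarrow> Y \<in> commutant T \<Longrightarrow> X ** Y \<in> commutant T"
    and "X \<in> commutant T \<Longrightarrow> X ** Y = mat 1 \<Longrightarrow> Y ** X = mat 1 \<Longrightarrow> Y \<in> commutant T"
proof -
  show "mat 1 \<in> commutant T"
    by (simp add: commutant_def)
  show "X + Y \<in> commutant T" if "X \<in> commutant T" "Y \<in> commutant T"
    using that by (simp add: commutant_def cmat_add_rdistrib matrix_add_ldistrib)
  show "cscale c X \<in> commutant T" if "X \<in> commutant T"
    using that by (simp add: commutant_def cscale_mult_left cscale_mult_right)
  show "X ** Y \<in> commutant T" if "X \<in> commutant T" "Y \<in> commutant T"
    using that by (auto simp: commutant_def) (metis matrix_mul_assoc)
  show "Y \<in> commutant T" if X: "X \<in> commutant T" and XY: "X ** Y = mat 1" "Y ** X = mat 1"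
    unfolding commutant_def
  proof (intro CollectI ballI)
    fix Z assume "Z \<in> T"
    then have "Y ** (X ** Z) ** Y = Y ** (Z ** X) ** Y"
      using X by (simp add: commutant_def)
    then have "(Y ** X) ** (Z ** Y) = (Y ** Z) ** (X ** Y)"
      by (simp only: matrix_mul_assoc)
    then show "Y ** Z = Z ** Y"
      by (simp add: XY)
  qed
qed

lemma von_neumann_algebra_closed:
  assumes "von_neumann_algebra M"
  shows "cmat.subspace M" "mat 1 \<in> M"
    and "\<And>X. X \<in> M \<Longrightarrow> adj X \<in> M"
    and "\<And>X Y. X \<in> M \<Longrightarrow> Y \<in> M \<Longrightarrow> X ** Y \<in> M"
    and "\<And>X Y. X \<in> M \<Longrightarrow> X ** Y = mat 1 \<Longrightarrow> Y ** X = mat 1 \<Longrightarrow> Y \<in> M"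
proof -
  have M: "M = commutant (commutant M)" and adj: "\<And>X. X \<in> M \<Longrightarrow> adj X \<in> M"
    using assms by (auto simp: von_neumann_algebra_def)
  have 0: "0 \<in> M"
    using commutant_closed(1,3)[where T = "commutant M"] M cmat.scale_zero_left by metis
  show "cmat.subspace M"
    unfolding cmat.subspace_def using 0 M commutant_closed(2,3) by metis
  show "mat 1 \<in> M" "\<And>X Y. X \<in> M \<Longrightarrow> Y \<in> M \<Longrightarrow> X ** Y \<in> M"
    "\<And>X Y. X \<in> M \<Longrightarrow> X ** Y = mat 1 \<Longrightarrow> Y ** X = mat 1 \<Longrightarrow> Y \<in> M"
    using M commutant_closed(1,4,5) by metis+
  show "\<And>X. X \<in> M \<Longrightarrow> adj X \<in> M"
    by (rule adj)
qed

lemma completely_positive_imp_positive: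
  assumes "completely_positive M \<Phi>" "X \<in> M" "psd X"
  shows "psd (\<Phi> X)"
proof -
  have "block_psd 1 (\<lambda>i j. X)"
    using assms(3) by (simp add: block_psd_def psd_def)
  then have b: "block_psd 1 (\<lambda>i j. \<Phi> X)"
    using assms(1,2) unfolding completely_positive_def by meson
  have "cip v (\<Phi> X *v v) \<in> \<real>\<^sub>\<ge>\<^sub>0" for v
    using b[unfolded block_psd_def, rule_format, of "\<lambda>_. v"] by simp
  then show ?thesis
    by (simp add: psd_def)
qed

lemma hermitian_plus_multiple_of_one_psd:
  fixes H :: "'n::finite cmat"
  assumes "adj H = H"
  obtains c where "psd (H + c *\<^sub>R mat 1)"
proof -
  obtain K where K: "\<And>v. norm (H *v v) \<le> norm v * K"
    using linear_mult_vec[of H] linear_conv_bounded_linear bounded_linear.bounded by blast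
  have "0 \<le> v \<bullet> ((H + K *\<^sub>R mat 1) *v v)" for v
  proof -
    have "\<bar>v \<bullet> (H *v v)\<bar> \<le> norm v * (norm v * K)"
      using Cauchy_Schwarz_ineq2[of v "H *v v"] mult_left_mono[OF K[of v], of "norm v"] by simp
    then have "0 \<le> v \<bullet> (H *v v) + K * (v \<bullet> v)"
      by (simp add: power2_norm_eq_inner[symmetric] power2_eq_square mult_ac abs_le_iff)
    then show ?thesis
      by (simp add: matrix_vector_mult_add_rdistrib scaleR_mult_vec inner_add_right)
  qed
  then have "psd (H + K *\<^sub>R mat 1)"
    using assms by (simp add: psd_iff adj_add adj_scaleR)
  then show ?thesis
    by (rule that)
qed

text \<open>A self-adjoint element becomes positive after adding a multiple of the unit, so positive unital
  maps preserve self-adjointness; the general case follows by splitting \<open>X\<close> into \<open>X + X\<^sup>*\<close> and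
  \<open>\<i> (X - X\<^sup>*)\<close>.\<close>

lemma positive_unital_adj:
  assumes M: "cmat.subspace M" "mat 1 \<in> M" "\<And>X. X \<in> M \<Longrightarrow> adj X \<in> M"
    and \<Phi>: "linear_map M N \<Phi>" and pos: "\<And>X. X \<in> M \<Longrightarrow> psd X \<Longrightarrow> psd (\<Phi> X)"
    and one: "\<Phi> (mat 1) = mat 1" and X: "X \<in> M"
  shows "\<Phi> (adj X) = adj (\<Phi> X)"
proof -
  note lin = linear_mapD[OF \<Phi>]
  note sub = complex_subspace_imp_subspace[OF M(1)]
  have herm: "adj (\<Phi> H) = \<Phi> H" if H: "H \<in> M" "adj H = H" for H
  proof -
    obtain c where c: "psd (H + c *\<^sub>R mat 1)"
      using hermitian_plus_multiple_of_one_psd[OF H(2)] by blast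
    have c1: "c *\<^sub>R mat 1 \<in> M"
      using sub M(2) by (rule subspace_scale)
    have "psd (\<Phi> (H + c *\<^sub>R mat 1))"
      using H(1) c1 sub by (intro pos c subspace_add)
    moreover have "\<Phi> (H + c *\<^sub>R mat 1) = \<Phi> H + c *\<^sub>R mat 1"
      using lin(2)[OF H(1) c1] lin(4)[OF M(2)] one by simp
    ultimately have "psd (\<Phi> H + c *\<^sub>R mat 1)"
      by simp
    from psd_adj[OF this] show ?thesis
      by (simp add: adj_add adj_scaleR)
  qed
  define P Q where "P = \<Phi> X" and "Q = \<Phi> (adj X)"
  note aX = M(3)[OF X]
  have "adj (\<Phi> (X + adj X)) = \<Phi> (X + adj X)"
    using X aX sub by (intro herm) (auto simp: adj_add subspace_add add.commute)
  then have 1: "adj P + adj Q = P + Q"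
    by (simp add: lin(2)[OF X aX] adj_add P_def Q_def)
  have mX: "cscale (-1) (adj X) \<in> M"
    using M(1) aX by (rule cmat.subspace_scale)
  have "X + cscale (-1) (adj X) \<in> M"
    using M(1) X mX by (rule cmat.subspace_add)
  moreover have "adj (cscale \<i> (X + cscale (-1) (adj X))) = cscale \<i> (X + cscale (-1) (adj X))"
    by (simp add: vec_eq_iff algebra_simps)
  ultimately have "adj (\<Phi> (cscale \<i> (X + cscale (-1) (adj X)))) = \<Phi> (cscale \<i> (X + cscale (-1) (adj X)))"
    using M(1) by (intro herm) (auto simp: cmat.subspace_scale)
  moreover have "\<Phi> (cscale \<i> (X + cscale (-1) (adj X))) = cscale \<i> (P + cscale (-1) Q)"
    by (simp only: lin(3)[OF \<open>X + cscale (-1) (adj X) \<in> M\<close>] lin(2)[OF X mX] lin(3)[OF aX] P_def Q_def)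
  ultimately have 2: "adj (cscale \<i> (P + cscale (-1) Q)) = cscale \<i> (P + cscale (-1) Q)"
    by simp
  have "Q $ i $ j = adj P $ i $ j" for i j
  proof -
    have "cnj (P $ j $ i) + cnj (Q $ j $ i) = P $ i $ j + Q $ i $ j"
      using arg_cong[OF 1, of "\<lambda>Z. Z $ i $ j"] by simp
    moreover have "\<i> * (cnj (Q $ j $ i) - cnj (P $ j $ i)) = \<i> * (P $ i $ j - Q $ i $ j)"
      using arg_cong[OF 2, of "\<lambda>Z. Z $ i $ j"] by (simp add: algebra_simps)
    then have "cnj (Q $ j $ i) - cnj (P $ j $ i) = P $ i $ j - Q $ i $ j"
      by simp
    ultimately have "(cnj (P $ j $ i) + cnj (Q $ j $ i)) - (cnj (Q $ j $ i) - cnj (P $ j $ i))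
        = (P $ i $ j + Q $ i $ j) - (P $ i $ j - Q $ i $ j)"
      by simp
    then have "2 * cnj (P $ j $ i) = 2 * Q $ i $ j"
      by (simp add: algebra_simps)
    then show ?thesis
      by simp
  qed
  then have "Q = adj P"
    by (simp add: vec_eq_iff)
  then show ?thesis
    by (simp add: P_def Q_def)
qed

lemma conditional_expectationD:
  assumes "conditional_expectation \<sigma> M N E"
  shows "linear_map M N E" "\<And>X. X \<in> N \<Longrightarrow> E X = X" "\<And>X. X \<in> M \<Longrightarrow> psd X \<Longrightarrow> psd (E X)"
    "E (mat 1) = mat 1"
    "\<And>A B X. A \<in> N \<Longrightarrow> B \<in> N \<Longrightarrow> X \<in> M \<Longrightarrow> E (A ** X ** B) = A ** E X ** B"
    "\<And>X. X \<in> M \<Longrightarrow> trace (\<sigma> ** E X) = trace (\<sigma> ** X)"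
  using assms completely_positive_imp_positive unfolding conditional_expectation_def by blast+

locale faithful_vna = faithful_state \<sigma> for \<sigma> :: "'n::finite cmat" +
  fixes M :: "'n cmat set"
  assumes vna: "von_neumann_algebra M" and sigma_M: "\<sigma> \<in> M"
begin

lemmas M_sub = von_neumann_algebra_closed(1)[OF vna]
  and M_one = von_neumann_algebra_closed(2)[OF vna]
  and M_adj = von_neumann_algebra_closed(3)[OF vna]
  and M_mult = von_neumann_algebra_closed(4)[OF vna]
  and M_inv = von_neumann_algebra_closed(5)[OF vna]

lemmas M_real_sub = complex_subspace_imp_subspace[OF M_sub]

context
  fixes N E
  assumes E: "conditional_expectation \<sigma> M N E" and NM: "N \<subseteq> M"
begin

lemmas E_linear_map = conditional_expectationD(1)[OF E]
  and E_id = conditional_expectationD(2)[OF E]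
  and E_pos = conditional_expectationD(3)[OF E]
  and E_one = conditional_expectationD(4)[OF E]
  and E_bimodule = conditional_expectationD(5)[OF E]
  and E_state = conditional_expectationD(6)[OF E]

lemmas E_lin = linear_mapD[OF conditional_expectationD(1)[OF E]]

lemma N_sub: "cmat.subspace N"
proof -
  have "0 \<in> N"
    using E_lin(1)[of "cscale 0 (mat 1)"] E_lin(3)[OF M_one, of 0] M_sub M_one cmat.subspace_0 by fastforce
  moreover have "X + Y \<in> N" if "X \<in> N" "Y \<in> N" for X Y
    using that NM E_lin(1)[of "X + Y"] E_lin(2)[of X Y] M_sub E_id cmat.subspace_add by (metis subsetD)
  moreover have "cscale c X \<in> N" if "X \<in> N" for X c
    using that NM E_lin(1)[of "cscale c X"] E_lin(3)[of X c] M_sub E_id cmat.subspace_scale by (metis subsetD)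
  ultimately show ?thesis
    by (simp add: cmat.subspace_def)
qed

lemma N_one: "mat 1 \<in> N"
  using E_lin(1)[OF M_one] E_one by simp

lemma E_adj: "X \<in> M \<Longrightarrow> E (adj X) = adj (E X)"
  by (rule positive_unital_adj[OF M_sub M_one M_adj E_linear_map E_pos E_one])

lemma N_adj: "X \<in> N \<Longrightarrow> adj X \<in> N"
  using E_adj[of X] E_id[of X] E_lin(1)[of "adj X"] M_adj[of X] NM by auto

text \<open>The bimodule property and invariance of the state give orthogonality for both of the
  inner products \<open>tr (\<sigma> X\<^sup>* Y)\<close> and \<open>tr (X\<^sup>* \<sigma> Y)\<close>; the KMS inner product lies between these two.\<close>

lemma E_gns_orthogonal:
  assumes A: "A \<in> N" and X: "X \<in> M"
  shows "trace (\<sigma> ** A ** (X - E X)) = 0" "trace (\<sigma> ** (X - E X) ** A) = 0"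
proof -
  have AM: "A \<in> M" using A NM by blast
  have "E (A ** X) = A ** E X" "E (X ** A) = E X ** A"
    using E_bimodule[OF A N_one X] E_bimodule[OF N_one A X] by auto
  then have "trace (\<sigma> ** (A ** E X)) = trace (\<sigma> ** (A ** X))" "trace (\<sigma> ** (E X ** A)) = trace (\<sigma> ** (X ** A))"
    using E_state[OF M_mult[OF AM X]] E_state[OF M_mult[OF X AM]] by auto
  moreover have "\<sigma> ** A ** (X - E X) = \<sigma> ** (A ** X) - \<sigma> ** (A ** E X)"
    by (simp add: cmat_diff_ldistrib matrix_mul_assoc)
  moreover have "\<sigma> ** (X - E X) ** A = \<sigma> ** (X ** A) - \<sigma> ** (E X ** A)"
    by (simp add: cmat_diff_ldistrib cmat_diff_rdistrib matrix_mul_assoc)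
  ultimately show "trace (\<sigma> ** A ** (X - E X)) = 0" "trace (\<sigma> ** (X - E X) ** A) = 0"
    by (simp_all add: trace_sub)
qed

end

lemma gns_definite:
  assumes "trace (\<sigma> ** adj X ** X) = 0"
  shows "X = 0"
proof -
  have "trace (adj (X ** S) ** (X ** S)) = trace ((S ** adj X ** X) ** S)"
    by (simp add: adj_mult adj_S matrix_mul_assoc)
  also have "\<dots> = trace ((S ** S) ** adj X ** X)"
    by (subst trace_mul_sym) (simp only: matrix_mul_assoc)
  finally have "(X ** S) \<bullet> (X ** S) = 0"
    using assms by (simp add: inner_cmat_eq_Re_hs_ip hs_ip_def SS)
  then have "X ** (R ** R) = 0"
    by (simp add: RR)
  moreover have "X ** (R ** R) ** (U ** U) = X ** (R ** (R ** U) ** U)"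
    by (simp only: matrix_mul_assoc)
  ultimately show ?thesis
    by (simp add: RU)
qed

text \<open>A conditional expectation is the orthogonal projection for \<open>tr (\<sigma> X\<^sup>* Y)\<close>, hence determined by its
  range.\<close>

lemma conditional_expectation_unique:
  assumes E1: "conditional_expectation \<sigma> M N E1" and E2: "conditional_expectation \<sigma> M N E2"
    and NM: "N \<subseteq> M" and X: "X \<in> M"
  shows "E1 X = E2 X"
proof -
  define D where "D = E1 X - E2 X"
  have "E1 X \<in> N" "E2 X \<in> N"
    using E_lin(1)[OF E1 NM X] E_lin(1)[OF E2 NM X] .
  then have D: "D \<in> N"
    unfolding D_def using complex_subspace_imp_subspace[OF N_sub[OF E1 NM]] by (simp add: subspace_diff)
  note aD = N_adj[OF E1 NM D]
  have "\<sigma> ** adj D ** D = \<sigma> ** adj D ** (X - E2 X) - \<sigma> ** adj D ** (X - E1 X)"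
    by (simp add: D_def cmat_diff_ldistrib)
  then have "trace (\<sigma> ** adj D ** D) = 0"
    using E_gns_orthogonal(1)[OF E1 NM aD X] E_gns_orthogonal(1)[OF E2 NM aD X] by (simp add: trace_sub)
  then have "D = 0"
    by (rule gns_definite)
  then show ?thesis
    by (simp add: D_def)
qed

text \<open>Orthogonality for both \<open>tr (\<sigma> X\<^sup>* Y)\<close> and \<open>tr (X\<^sup>* \<sigma> Y)\<close> makes \<open>N\<close> invariant under
  \<open>A \<mapsto> \<sigma>\<^sup>-\<^sup>1 A \<sigma>\<close> (the necessary condition in Takesaki's theorem).  This map is positive for the
  Hilbert--Schmidt inner product with positive square root \<open>A \<mapsto> \<sigma>\<^sup>-\<^sup>1\<^sup>/\<^sup>2 A \<sigma>\<^sup>1\<^sup>/\<^sup>2\<close>, so \<open>N\<close> is invariant under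
  the root as well, and
  \<open>\<langle>A, Y\<rangle> = tr (\<sigma>\<^sup>1\<^sup>/\<^sup>2 A\<^sup>* \<sigma>\<^sup>1\<^sup>/\<^sup>2 Y) = tr (\<sigma> B Y)\<close> with \<open>B = \<sigma>\<^sup>-\<^sup>1\<^sup>/\<^sup>2 A\<^sup>* \<sigma>\<^sup>1\<^sup>/\<^sup>2 \<in> N\<close>.\<close>

theorem conditional_expectation_kms_orthogonal:
  assumes E: "conditional_expectation \<sigma> M N E" and NM: "N \<subseteq> M"
    and A: "A \<in> N" and X: "X \<in> M"
  shows "J A \<bullet> J (X - E X) = 0"
proof -
  note N = complex_subspace_imp_subspace[OF N_sub[OF E NM]]
  define \<tau> where "\<tau> = (U ** U) ** (U ** U)"
  define D where "D A = (U ** U) ** A ** (R ** R)" for A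
  define D2 where "D2 A = \<tau> ** A ** \<sigma>" for A
  have UU_RR: "(U ** U) ** (R ** R) = mat 1" "(R ** R) ** (U ** U) = mat 1"
  proof -
    have "(U ** U) ** (R ** R) = U ** (U ** R) ** R" "(R ** R) ** (U ** U) = R ** (R ** U) ** U"
      by (simp_all only: matrix_mul_assoc)
    then show "(U ** U) ** (R ** R) = mat 1" "(R ** R) ** (U ** U) = mat 1"
      by (simp_all add: UR RU)
  qed
  have sigma: "\<sigma> = (R ** R) ** (R ** R)"
    by (simp only: RR SS)
  have "\<tau> ** ((R ** R) ** (R ** R)) = (U ** U) ** ((U ** U) ** (R ** R)) ** (R ** R)"
    unfolding \<tau>_def by (simp only: matrix_mul_assoc)
  then have ts: "\<tau> ** \<sigma> = mat 1"
    by (simp only: UU_RR matrix_mul_rid sigma[symmetric])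
  then have st: "\<sigma> ** \<tau> = mat 1"
    using matrix_left_right_inverse by blast
  have tau_M: "\<tau> \<in> M"
    using M_inv[OF sigma_M st ts] .
  \<comment> \<open>For \<open>tr (\<sigma> X\<^sup>* Y)\<close> the adjoint of \<open>D2 A\<close> is orthogonal to the kernel of \<open>E\<close>, so it lies in \<open>N\<close>.\<close>
  have D2_N: "D2 A \<in> N" if A: "A \<in> N" for A
  proof -
    define W where "W = adj (D2 A)"
    have W_M: "W \<in> M"
      unfolding W_def D2_def using A NM tau_M sigma_M by (intro M_adj M_mult) auto
    define Y where "Y = W - E W"
    have "trace (\<sigma> ** adj W ** Y) = trace ((\<sigma> ** \<tau>) ** (A ** \<sigma> ** Y))"
      by (simp add: W_def D2_def matrix_mul_assoc)
    also have "\<dots> = trace (A ** (\<sigma> ** Y))"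
      by (simp add: st matrix_mul_assoc)
    also have "\<dots> = trace (\<sigma> ** Y ** A)"
      by (rule trace_mul_sym)
    also have "\<dots> = 0"
      unfolding Y_def using E_gns_orthogonal(2)[OF E NM A W_M] .
    finally have 1: "trace (\<sigma> ** adj W ** Y) = 0" .
    have EW: "E W \<in> N"
      using E_lin(1)[OF E NM W_M] .
    have 2: "trace (\<sigma> ** adj (E W) ** Y) = 0"
      unfolding Y_def using E_gns_orthogonal(1)[OF E NM N_adj[OF E NM EW] W_M] .
    have "\<sigma> ** adj Y ** Y = \<sigma> ** adj W ** Y - \<sigma> ** adj (E W) ** Y"
      unfolding Y_def by (simp add: adj_diff cmat_diff_ldistrib cmat_diff_rdistrib)
    then have "trace (\<sigma> ** adj Y ** Y) = 0"
      using 1 2 by (simp add: trace_sub)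
    then have "W = E W"
      using gns_definite[of Y] by (simp add: Y_def)
    then have "adj W \<in> N"
      using N_adj[OF E NM EW] by simp
    then show ?thesis
      by (simp add: W_def)
  qed
  have linD: "linear D" and linD2: "linear D2"
    unfolding D_def[abs_def] D2_def[abs_def] by (rule linear_sandwich)+
  have aUU: "adj (U ** U) = U ** U" and aRR: "adj (R ** R) = R ** R" and at: "adj \<tau> = \<tau>"
    by (simp_all add: adj_mult adj_U adj_R \<tau>_def)
  have DD: "D (D A) = D2 A" for A
  proof -
    have "D (D A) = \<tau> ** A ** ((R ** R) ** (R ** R))"
      unfolding D_def \<tau>_def by (simp only: matrix_mul_assoc)
    then show ?thesis
      by (simp only: D2_def sigma[symmetric])
  qed
  have D_sym: "D A \<bullet> B = A \<bullet> D B" for A B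
    unfolding D_def by (rule hermitian_sandwich_symmetric[OF aUU aRR])
  have D2_sym: "D2 A \<bullet> B = A \<bullet> D2 B" for A B
    unfolding D2_def by (rule hermitian_sandwich_symmetric[OF at adj_sigma])
  have D_pos: "0 \<le> A \<bullet> D A" for A
  proof -
    have "D A = U ** (U ** A ** R) ** R"
      unfolding D_def by (simp only: matrix_mul_assoc)
    then have "A \<bullet> D A = (U ** A ** R) \<bullet> (U ** A ** R)"
      using hermitian_sandwich_symmetric[OF adj_U adj_R, of A "U ** A ** R"] by simp
    then show ?thesis by simp
  qed
  have D_N: "D A \<in> N" if "A \<in> N" for A
  proof -
    have "N \<subseteq> span {x\<in>N. \<exists>r. D2 x = r *\<^sub>R x}"
      using symmetric_spanned_by_eigenvectors[OF linD2 N D2_N D2_sym] by blast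
    moreover have "{x\<in>N. \<exists>r. D2 x = r *\<^sub>R x} \<subseteq> D -` N"
    proof
      fix x assume "x \<in> {x\<in>N. \<exists>r. D2 x = r *\<^sub>R x}"
      then obtain r where x: "x \<in> N" "D (D x) = r *\<^sub>R x"
        by (auto simp: DD)
      have "D x = sqrt r *\<^sub>R x"
        by (rule positive_root_on_eigenvector[OF linD D_sym D_pos x(2)])
      then show "x \<in> D -` N"
        using x(1) N by (simp add: subspace_scale)
    qed
    then have "span {x\<in>N. \<exists>r. D2 x = r *\<^sub>R x} \<subseteq> D -` N"
      by (rule span_minimal) (rule linear_subspace_vimage[OF linD N])
    ultimately show ?thesis
      using that by blast
  qed
  define B where "B = D (adj A)"
  have B: "B \<in> N"
    unfolding B_def using N_adj[OF E NM A] by (rule D_N)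
  have "((R ** R) ** (R ** R)) ** B = (R ** R) ** ((R ** R) ** (U ** U)) ** adj A ** (R ** R)"
    unfolding B_def D_def by (simp only: matrix_mul_assoc)
  then have "((R ** R) ** (R ** R)) ** B = (R ** R) ** adj A ** (R ** R)"
    by (simp only: UU_RR matrix_mul_rid)
  then have "\<sigma> ** B = S ** adj A ** S"
    by (simp only: RR SS)
  then have "kms_ip \<sigma> A (X - E X) = trace (\<sigma> ** B ** (X - E X))"
    by (simp add: kms_ip_def)
  also have "\<dots> = 0"
    by (rule E_gns_orthogonal(1)[OF E NM B X])
  finally show ?thesis
    by (simp flip: Re_kms_ip)
qed

end

section \<open>Semigroups and their generators\<close>

lemma sg_exp_summable:
  fixes L :: "'n::finite cmat \<Rightarrow> 'n cmat"
  assumes L: "linear L"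
  shows "summable (\<lambda>k. norm ((t ^ k / fact k) *\<^sub>R (L ^^ k) X))"
proof -
  obtain K where K: "K > 0" "\<And>X. norm (L X) \<le> norm X * K"
    using L linear_conv_bounded_linear bounded_linear.pos_bounded by blast
  have pow: "norm ((L ^^ k) X) \<le> K ^ k * norm X" for k
  proof (induction k)
    case (Suc k)
    have "norm ((L ^^ Suc k) X) \<le> norm ((L ^^ k) X) * K"
      using K(2) by simp
    also have "\<dots> \<le> (K ^ k * norm X) * K"
      using Suc K(1) by (intro mult_right_mono) auto
    finally show ?case
      by (simp add: mult_ac)
  qed simp
  have "summable (\<lambda>k. (inverse (fact k) * (\<bar>t\<bar> * K) ^ k) * norm X)"
    by (intro summable_mult2 summable_exp)
  then show ?thesis
  proof (rule summable_comparison_test_ev[rotated], intro always_eventually allI)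
    fix k
    have "norm (norm ((t ^ k / fact k) *\<^sub>R (L ^^ k) X)) = \<bar>t\<bar> ^ k / fact k * norm ((L ^^ k) X)"
      by (simp add: power_abs)
    also have "\<dots> \<le> \<bar>t\<bar> ^ k / fact k * (K ^ k * norm X)"
      by (intro mult_left_mono pow) auto
    finally show "norm (norm ((t ^ k / fact k) *\<^sub>R (L ^^ k) X)) \<le> (inverse (fact k) * (\<bar>t\<bar> * K) ^ k) * norm X"
      by (simp add: divide_inverse power_mult_distrib mult_ac)
  qed
qed

lemma sg_exp_bounded_linear:
  fixes h :: "'n::finite cmat \<Rightarrow> 'b::real_normed_vector"
  assumes L: "linear L" and h: "linear h"
  shows "h (sg_exp L t X) = (\<Sum>k. (t ^ k / fact k) *\<^sub>R h ((L ^^ k) X))"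
    "summable (\<lambda>k. (t ^ k / fact k) *\<^sub>R h ((L ^^ k) X))"
proof -
  have bl: "bounded_linear h"
    using h linear_conv_bounded_linear by blast
  have s: "summable (\<lambda>k. (t ^ k / fact k) *\<^sub>R (L ^^ k) X)"
    by (rule summable_norm_cancel[OF sg_exp_summable[OF L]])
  show "h (sg_exp L t X) = (\<Sum>k. (t ^ k / fact k) *\<^sub>R h ((L ^^ k) X))"
    unfolding sg_exp_def using bounded_linear.suminf[OF bl s] by (simp add: linear_scale[OF h])
  show "summable (\<lambda>k. (t ^ k / fact k) *\<^sub>R h ((L ^^ k) X))"
    using bounded_linear.summable[OF bl s] by (simp add: linear_scale[OF h])
qed

lemma sg_exp_commute:
  assumes "linear L"
  shows "L (sg_exp L t X) = sg_exp L t (L X)"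
  unfolding sg_exp_bounded_linear(1)[OF assms assms] by (simp add: sg_exp_def funpow_swap1)

lemma sg_exp_0: "sg_exp L 0 X = X"
proof -
  have "sg_exp L 0 X = (\<Sum>k. if k = 0 then X else 0)"
    unfolding sg_exp_def by (intro suminf_cong) auto
  then show ?thesis
    using suminf_finite[of "{0::nat}" "\<lambda>k. if k = 0 then X else 0"] by simp
qed

text \<open>Each coordinate of the exponential series is a real power series, which may be differentiated
  termwise.\<close>

lemma sg_exp_has_derivative:
  fixes L :: "'n::finite cmat \<Rightarrow> 'n cmat"
  assumes L: "linear L"
  shows "((\<lambda>t. sg_exp L t X) has_vector_derivative sg_exp L t (L X)) (at t)"
proof -
  have "((\<lambda>t. sg_exp L t X \<bullet> b) has_real_derivative sg_exp L t (L X) \<bullet> b) (at t)" for b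
  proof -
    have lin: "linear (\<lambda>Y. Y \<bullet> b)"
      by (rule linearI) (simp_all add: inner_simps)
    define c where "c n = ((L ^^ n) X \<bullet> b) / fact n" for n
    have s: "summable (\<lambda>n. c n * y ^ n)" for y
      using sg_exp_bounded_linear(2)[OF L lin, of y X] by (simp add: c_def mult_ac)
    have f: "sg_exp L y X \<bullet> b = (\<Sum>n. c n * y ^ n)" for y
      using sg_exp_bounded_linear(1)[OF L lin, of y X] by (simp add: c_def mult_ac)
    have d: "diffs c n = ((L ^^ n) (L X) \<bullet> b) / fact n" for n
      by (simp add: diffs_def c_def funpow_swap1)
    have "(\<Sum>n. diffs c n * t ^ n) = sg_exp L t (L X) \<bullet> b"
      using sg_exp_bounded_linear(1)[OF L lin, of t "L X"] by (simp add: d mult_ac)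
    then show ?thesis
      using termdiffs_strong_converges_everywhere[of c t, OF s] by (simp add: f)
  qed
  then show ?thesis
    unfolding has_vector_derivative_def
    by (subst has_derivative_componentwise_within) (simp add: has_field_derivative_def mult_commute_abs)
qed

lemma sg_exp_functional_derivative:
  fixes L :: "'n::finite cmat \<Rightarrow> 'n cmat" and h :: "'n cmat \<Rightarrow> 'b::real_normed_vector"
  assumes L: "linear L" and h: "linear h"
  shows "((\<lambda>t. h (sg_exp L t X)) has_vector_derivative h (sg_exp L t (L X))) (at t)"
  using bounded_linear.has_vector_derivative[OF _ sg_exp_has_derivative[OF L]] h linear_conv_bounded_linear by blast

lemma sg_exp_cong:
  assumes "\<And>X. X \<in> M \<Longrightarrow> L X \<in> M" "\<And>X. X \<in> M \<Longrightarrow> L' X = L X" "X \<in> M"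
  shows "sg_exp L' t X = sg_exp L t X"
proof -
  have "(L' ^^ k) X = (L ^^ k) X \<and> (L ^^ k) X \<in> M" for k
    by (induction k) (use assms in auto)
  then show ?thesis
    by (simp add: sg_exp_def)
qed

lemma sg_exp_in_subspace:
  fixes L :: "'n::finite cmat \<Rightarrow> 'n cmat"
  assumes L: "linear L" and V: "subspace V" "\<And>X. X \<in> V \<Longrightarrow> L X \<in> V" and X: "X \<in> V"
  shows "sg_exp L t X \<in> V"
proof -
  have k: "(L ^^ k) X \<in> V" for k
    by (induction k) (use V X in auto)
  have s: "summable (\<lambda>k. (t ^ k / fact k) *\<^sub>R (L ^^ k) X)"
    by (rule summable_norm_cancel[OF sg_exp_summable[OF L]])
  show ?thesis
  proof (rule Lim_in_closed_set)
    show "closed V"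
      using V(1) by (rule closed_subspace)
    show "((\<lambda>n. \<Sum>k<n. (t ^ k / fact k) *\<^sub>R (L ^^ k) X) \<longlongrightarrow> sg_exp L t X) sequentially"
      unfolding sg_exp_def using s by (rule summable_LIMSEQ)
    show "\<forall>\<^sub>F n in sequentially. (\<Sum>k<n. (t ^ k / fact k) *\<^sub>R (L ^^ k) X) \<in> V"
      using V(1) k by (intro always_eventually allI subspace_sum subspace_scale)
  qed simp
qed

lemma linear_cscale: "linear (cscale c)"
  by (rule linearI) (simp_all add: cmat.scale_right_distrib flip: cscale_of_real)

lemma sg_exp_linear_map:
  assumes M: "cmat.subspace M" and \<Phi>: "linear_map M M \<Phi>"
  shows "linear_map M M (sg_exp \<Phi> t)"
proof -
  obtain L where L: "linear L" "\<And>X. X \<in> M \<Longrightarrow> L X = \<Phi> X"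
    using linear_map_extension[OF M \<Phi>] by blast
  have inv: "\<Phi> X \<in> M" if "X \<in> M" for X
    using linear_mapD(1)[OF \<Phi> that] .
  have eq: "sg_exp \<Phi> t X = sg_exp L t X" if "X \<in> M" for X
    using sg_exp_cong[of M \<Phi> L X t] L(2) inv that by simp
  have Lp: "linear (L ^^ k)" for k
  proof (induction k)
    case (Suc k)
    then show ?case
      using linear_compose[OF _ L(1)] by (simp add: o_def)
  qed (simp add: linear_id[unfolded id_def])
  have Lc: "(L ^^ k) (cscale c X) = cscale c ((L ^^ k) X) \<and> (L ^^ k) X \<in> M" if "X \<in> M" for k c X
    by (induction k)
      (use that L(2) inv linear_mapD(3)[OF \<Phi>] M in \<open>auto simp: cmat.subspace_scale\<close>)
  have s: "summable (\<lambda>k. (t ^ k / fact k) *\<^sub>R (L ^^ k) X)" for X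
    by (rule summable_norm_cancel[OF sg_exp_summable[OF L(1)]])
  have "sg_exp L t (X + Y) = sg_exp L t X + sg_exp L t Y" for X Y
    unfolding sg_exp_def using suminf_add[OF s[of X] s[of Y]]
    by (simp add: linear_add[OF Lp] scaleR_add_right)
  moreover have "sg_exp L t (cscale c X) = cscale c (sg_exp L t X)" if "X \<in> M" for c X
    unfolding sg_exp_bounded_linear(1)[OF L(1) linear_cscale] using Lc[OF that] by (simp add: sg_exp_def)
  moreover have "sg_exp L t X \<in> M" if "X \<in> M" for X
    using sg_exp_in_subspace[OF L(1) complex_subspace_imp_subspace[OF M]] L(2) inv that by simp
  ultimately show ?thesis
    unfolding linear_map_def using M by (simp add: eq cmat.subspace_add cmat.subspace_scale)
qed

lemma nonneg_derivative_at_0: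
  fixes f :: "real \<Rightarrow> real"
  assumes "(f has_vector_derivative d) (at 0)" "\<And>t. t \<ge> 0 \<Longrightarrow> f 0 \<le> f t"
  shows "0 \<le> d"
proof (rule ccontr)
  assume "\<not> 0 \<le> d"
  moreover have "(f has_real_derivative d) (at 0)"
    using assms(1) by (simp add: has_real_derivative_iff_has_vector_derivative)
  ultimately obtain e where "e > 0" "\<And>h. 0 < h \<Longrightarrow> h < e \<Longrightarrow> f (0 + h) < f 0"
    using DERIV_neg_dec_right[of f d 0] by auto
  then show False
    using assms(2)[of "e / 2"] by (metis add_0 half_gt_zero less_divide_eq_numeral1(1) not_le
        field_sum_of_halves less_add_same_cancel1 order_less_imp_le)
qed

text \<open>A linear functional whose value is smallest at time \<open>0\<close> has a nonnegative derivative there.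
  This is how positivity and unitality of the semigroup pass to the generator.\<close>

lemma qms_generator_derivative:
  fixes h :: "'n::finite cmat \<Rightarrow> real"
  assumes M: "cmat.subspace M" and G: "qms_generator M G" and h: "linear h"
    and X: "X \<in> M" and le: "\<And>t. t \<ge> 0 \<Longrightarrow> h X \<le> h (sg_exp G t X)"
  shows "0 \<le> h (G X)"
proof -
  have lm: "linear_map M M G"
    using G by (simp add: qms_generator_def)
  obtain L where L: "linear L" "\<And>X. X \<in> M \<Longrightarrow> L X = G X"
    using linear_map_extension[OF M lm] by blast
  have eq: "sg_exp L t X = sg_exp G t X" for t
    using sg_exp_cong[of M G L X t] L(2) linear_mapD(1)[OF lm] X by simp
  have "((\<lambda>t. h (sg_exp L t X)) has_vector_derivative h (G X)) (at 0)"
    using sg_exp_functional_derivative[OF L(1) h, of X 0] L(2)[OF X] by (simp add: sg_exp_0)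
  then show ?thesis
    by (rule nonneg_derivative_at_0) (simp add: eq sg_exp_0 le)
qed

lemma qms_generator_one:
  fixes M :: "'n::finite cmat set"
  assumes M: "cmat.subspace M" "mat 1 \<in> M" and G: "qms_generator M G"
  shows "G (mat 1) = 0"
proof -
  have lin: "linear (\<lambda>Y. c * (Y \<bullet> G (mat 1)))" for c
    by (rule linearI) (simp_all add: inner_simps algebra_simps)
  have "0 \<le> (-1) * (G (mat 1) \<bullet> G (mat 1))"
    using G by (intro qms_generator_derivative[OF M(1) G lin M(2)]) (simp add: qms_generator_def)
  then have "\<not> 0 < G (mat 1) \<bullet> G (mat 1)"
    by linarith
  then show ?thesis
    by (simp only: inner_gt_zero_iff not_not)
qed

lemma qms_generator_adj:
  fixes M :: "'n::finite cmat set"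
  assumes vna: "von_neumann_algebra M" and G: "qms_generator M G" and X: "X \<in> M"
  shows "G (adj X) = adj (G X)"
proof -
  note M = von_neumann_algebra_closed(1-3)[OF vna]
  have lm: "linear_map M M G"
    using G by (simp add: qms_generator_def)
  obtain L where L: "linear L" "\<And>X. X \<in> M \<Longrightarrow> L X = G X"
    using linear_map_extension[OF M(1) lm] by blast
  have eq: "sg_exp L t Y = sg_exp G t Y" if "Y \<in> M" for t Y
    using sg_exp_cong[of M G L Y t] L(2) linear_mapD(1)[OF lm] that by simp
  have adj: "sg_exp G t (adj X) = adj (sg_exp G t X)" if "t \<ge> 0" for t
    using G that completely_positive_imp_positive
    by (intro positive_unital_adj[OF M sg_exp_linear_map[OF M(1) lm] _ _ X]) (auto simp: qms_generator_def)
  define D where "D = G (adj X) - adj (G X)"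
  have lin: "linear (\<lambda>Y. - (Y \<bullet> D))" "linear (\<lambda>Y. adj Y \<bullet> D)"
    by (rule linearI; simp add: inner_simps adj_add adj_scaleR)+
  have "((\<lambda>t. - (sg_exp L t (adj X) \<bullet> D) + adj (sg_exp L t X) \<bullet> D) has_vector_derivative
      - (G (adj X) \<bullet> D) + adj (G X) \<bullet> D) (at 0)"
    using has_vector_derivative_add[OF sg_exp_functional_derivative[OF L(1) lin(1), of "adj X" 0]
        sg_exp_functional_derivative[OF L(1) lin(2), of X 0]] L(2) X M(3)[OF X] by (simp add: sg_exp_0)
  then have "0 \<le> - (G (adj X) \<bullet> D) + adj (G X) \<bullet> D"
    by (rule nonneg_derivative_at_0) (simp add: eq X M(3) adj sg_exp_0)
  then have "D \<bullet> D \<le> 0"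
    by (simp add: D_def inner_diff_left)
  then have "D = 0"
    by (simp only: inner_gt_zero_iff not_not flip: not_less)
  then show ?thesis
    by (simp add: D_def)
qed

text \<open>If \<open>r\<close> is the minimum of the quadratic form of \<open>X\<close>, attained at \<open>v\<close>, then \<open>X - r\<close> is positive and
  stays positive, so \<open>\<langle>v, P\<^sub>t (X - r) v\<rangle>\<close> is smallest at time \<open>0\<close>, where it vanishes; and \<open>G\<close>
  annihilates the constant \<open>r\<close>.\<close>

lemma qms_generator_minimum_principle:
  fixes M :: "'n::finite cmat set"
  assumes vna: "von_neumann_algebra M" and G: "qms_generator M G" and X: "X \<in> M"
    and psd: "psd (X - r *\<^sub>R mat 1)" and v: "v \<bullet> (X *v v) = r * (v \<bullet> v)"
  shows "0 \<le> v \<bullet> (G X *v v)"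
proof -
  note M = von_neumann_algebra_closed(1-3)[OF vna]
  note sub = complex_subspace_imp_subspace[OF M(1)]
  have lm: "linear_map M M G"
    using G by (simp add: qms_generator_def)
  define Y where "Y = X + (- r) *\<^sub>R mat 1"
  have r1: "(- r) *\<^sub>R mat 1 \<in> M"
    using sub M(2) by (rule subspace_scale)
  have Y: "Y \<in> M"
    unfolding Y_def using sub X r1 by (rule subspace_add)
  have GY: "G Y = G X"
    unfolding Y_def linear_mapD(2)[OF lm X r1] linear_mapD(4)[OF lm M(2)]
    using qms_generator_one[OF M(1,2) G] by simp
  have lin: "linear (\<lambda>Z. v \<bullet> (Z *v v))"
    by (rule linearI) (simp_all add: linear_add[OF linear_mult_vec_left] linear_scale[OF linear_mult_vec_left] inner_simps)
  have "0 \<le> v \<bullet> (G Y *v v)"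
  proof (rule qms_generator_derivative[OF M(1) G lin Y])
    fix t :: real assume "t \<ge> 0"
    then have "psd (sg_exp G t Y)"
      using G Y psd completely_positive_imp_positive by (auto simp: qms_generator_def Y_def)
    moreover have "v \<bullet> (Y *v v) = 0"
      using v by (simp add: Y_def matrix_vector_mult_diff_rdistrib scaleR_mult_vec inner_diff_right)
    ultimately show "v \<bullet> (Y *v v) \<le> v \<bullet> (sg_exp G t Y *v v)"
      by (simp add: psd_iff)
  qed
  then show ?thesis
    by (simp add: GY)
qed

section \<open>Dissipative generators and decay of the semigroup\<close>

context faithful_state
begin

lemma dissipative_imp_contraction:
  assumes L: "linear L" and M: "subspace M" "\<And>X. X \<in> M \<Longrightarrow> L X \<in> M"
    and diss: "\<And>X. X \<in> M \<Longrightarrow> J X \<bullet> J (L X) \<le> 0" and X: "X \<in> M" and t: "0 \<le> t"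
  shows "norm (J (sg_exp L t X)) \<le> norm (J X)"
proof -
  let ?f = "\<lambda>s. J (sg_exp L s X)"
  have f: "(?f has_vector_derivative J (L (sg_exp L s X))) (at s)" for s
    using sg_exp_functional_derivative[OF L linear_J, of X s] by (simp add: sg_exp_commute[OF L])
  have "((\<lambda>s. ?f s \<bullet> ?f s) has_real_derivative 2 * (?f s \<bullet> J (L (sg_exp L s X)))) (at s)" for s
    using bounded_bilinear.has_vector_derivative[OF bounded_bilinear_inner f[of s] f[of s]]
    by (simp add: has_real_derivative_iff_has_vector_derivative inner_commute)
  moreover have "2 * (?f s \<bullet> J (L (sg_exp L s X))) \<le> 0" for s
    using diss[OF sg_exp_in_subspace[OF L M X]] by simp
  ultimately have "?f t \<bullet> ?f t \<le> ?f 0 \<bullet> ?f 0"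
    using t by (intro DERIV_nonpos_imp_nonincreasing[of 0 t "\<lambda>s. ?f s \<bullet> ?f s"]) blast+
  then show ?thesis
    by (simp add: norm_le sg_exp_0)
qed

text \<open>The estimate \<open>\<parallel>P\<^sub>b X - P\<^sub>a X\<parallel> \<le> \<integral>\<^sub>a\<^sup>b \<parallel>P\<^sub>t L X\<parallel> dt\<close>, with \<open>\<phi>\<close> an antiderivative of a majorant of the
  integrand.\<close>

lemma sg_exp_increment_bound:
  assumes L: "linear L" and ab: "a \<le> b"
    and \<phi>: "\<And>t. (\<phi> has_real_derivative \<phi>' t) (at t)"
    and bd: "\<And>t. a < t \<Longrightarrow> t < b \<Longrightarrow> norm (J (sg_exp L t (L X))) \<le> \<phi>' t"
  shows "norm (J (sg_exp L b X) - J (sg_exp L a X)) \<le> \<phi> b - \<phi> a"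
proof (cases "a = b")
  case False
  have f: "((\<lambda>t. J (sg_exp L t X)) has_vector_derivative J (sg_exp L t (L X))) (at t)" for t
    by (rule sg_exp_functional_derivative[OF L linear_J])
  have g: "(\<phi> has_vector_derivative \<phi>' t) (at t)" for t
    using \<phi> by (simp add: has_real_derivative_iff_has_vector_derivative)
  show ?thesis
  proof (rule differentiable_bound_general)
    show "a < b" using ab False by simp
    show "continuous_on {a..b} (\<lambda>t. J (sg_exp L t X))" "continuous_on {a..b} \<phi>"
      using f g has_vector_derivative_continuous
      by (blast intro: continuous_at_imp_continuous_on)+
  qed (use f g bd in auto)
qed simp

text \<open>From \<open>X = - \<integral>\<^sub>0\<^sup>\<infinity> P\<^sub>t L X dt\<close> and \<open>\<parallel>P\<^sub>t L X\<parallel> \<le> min 1 (C e\<^sup>-\<^sup>\<nu>\<^sup>t) \<parallel>L X\<parallel>\<close>.  The minimum switches at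
  \<open>t0 = ln C / \<nu>\<close>: the part before \<open>t0\<close> contributes \<open>ln C / \<nu>\<close> and the part after it \<open>1 / \<nu>\<close>.\<close>

lemma norm_le_by_decay:
  assumes L: "linear L" and C: "C \<ge> 1" and \<nu>: "\<nu> > 0"
    and contr: "\<And>t. 0 \<le> t \<Longrightarrow> norm (J (sg_exp L t (L X))) \<le> norm (J (L X))"
    and dec: "\<And>t. 0 \<le> t \<Longrightarrow> norm (J (sg_exp L t (L X))) \<le> C * exp (- \<nu> * t) * norm (J (L X))"
    and dec0: "\<And>t. 0 \<le> t \<Longrightarrow> norm (J (sg_exp L t X)) \<le> C * exp (- \<nu> * t) * norm (J X)"
  shows "norm (J X) \<le> (1 + ln C) / \<nu> * norm (J (L X))"
proof -
  define n where "n = norm (J (L X))"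
  define t0 where "t0 = ln C / \<nu>"
  define \<phi> where "\<phi> t = - (C / \<nu>) * exp (- \<nu> * t) * n" for t
  have t0: "0 \<le> t0"
    using C \<nu> by (simp add: t0_def)
  have "norm (J (sg_exp L t0 X) - J (sg_exp L 0 X)) \<le> t0 * n - 0 * n"
  proof (rule sg_exp_increment_bound[OF L t0, where \<phi>' = "\<lambda>_. n"])
    show "((\<lambda>t. t * n) has_real_derivative n) (at t)" for t
      by (auto intro!: derivative_eq_intros)
  qed (use contr in \<open>auto simp: n_def\<close>)
  then have 1: "norm (J (sg_exp L t0 X) - J X) \<le> t0 * n"
    by (simp add: sg_exp_0)
  have \<phi>t0: "\<phi> t0 = - n / \<nu>"
    using C \<nu> by (simp add: \<phi>_def t0_def exp_minus)
  have 2: "norm (J (sg_exp L T X) - J (sg_exp L t0 X)) \<le> n / \<nu>" if T: "t0 \<le> T" for T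
  proof -
    have "norm (J (sg_exp L T X) - J (sg_exp L t0 X)) \<le> \<phi> T - \<phi> t0"
    proof (rule sg_exp_increment_bound[OF L T, where \<phi>' = "\<lambda>t. C * exp (- \<nu> * t) * n"])
      show "(\<phi> has_real_derivative C * exp (- \<nu> * t) * n) (at t)" for t
        unfolding \<phi>_def using \<nu> by (auto intro!: derivative_eq_intros)
    qed (use dec t0 in \<open>auto simp: n_def\<close>)
    moreover have "\<phi> T \<le> 0"
      using C \<nu> by (simp add: \<phi>_def n_def)
    ultimately show ?thesis
      by (simp add: \<phi>t0)
  qed
  have "norm (J X) \<le> (t0 * n + n / \<nu>) + C * exp (- \<nu> * T) * norm (J X)" if T: "t0 \<le> T" for T
  proof -
    have "norm (J X) \<le> norm (J (sg_exp L t0 X) - J X) + norm (J (sg_exp L T X) - J (sg_exp L t0 X))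
        + norm (J (sg_exp L T X))"
      by (smt (verit) norm_minus_commute norm_triangle_sub)
    then show ?thesis
      using 1 2[OF T] dec0[of T] t0 T by simp
  qed
  then have "\<forall>\<^sub>F T in at_top. norm (J X) \<le> (t0 * n + n / \<nu>) + C * exp (- \<nu> * T) * norm (J X)"
    by (rule eventually_mono[OF eventually_ge_at_top[of t0]])
  moreover have "((\<lambda>T. (t0 * n + n / \<nu>) + C * exp (- \<nu> * T) * norm (J X)) \<longlongrightarrow> (t0 * n + n / \<nu>) + C * 0 * norm (J X)) at_top"
  proof (intro tendsto_intros)
    have "filterlim (\<lambda>T. - \<nu> * T) at_bot at_top"
      using \<nu> by (intro filterlim_tendsto_neg_mult_at_bot[OF tendsto_const _ filterlim_ident]) auto
    then show "((\<lambda>T. exp (- \<nu> * T)) \<longlongrightarrow> 0) at_top"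
      by (rule filterlim_compose[OF exp_at_bot])
  qed
  ultimately have "norm (J X) \<le> (t0 * n + n / \<nu>) + C * 0 * norm (J X)"
    by (intro tendsto_lowerbound) auto
  then show ?thesis
    by (simp add: t0_def n_def add_divide_distrib algebra_simps)
qed

end

context faithful_vna
begin

lemma symmetric_part_adj:
  assumes LA: "linear_map M M LA" and LS: "linear_map M M LS"
    and qms: "\<And>\<gamma>. \<gamma> > 0 \<Longrightarrow> qms_generator M (lift_generator LA LS \<gamma>)" and X: "X \<in> M"
  shows "LS (adj X) = adj (LS X)"
proof -
  have "LA (adj X) + \<gamma> *\<^sub>R LS (adj X) = adj (LA X) + \<gamma> *\<^sub>R adj (LS X)" if "\<gamma> > 0" for \<gamma>
    using qms_generator_adj[OF vna qms[OF that] X] by (simp add: lift_generator_def adj_add adj_scaleR)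
  from this[of 1] this[of 2]
  have "(LA (adj X) + 2 *\<^sub>R LS (adj X)) - (LA (adj X) + 1 *\<^sub>R LS (adj X))
      = (adj (LA X) + 2 *\<^sub>R adj (LS X)) - (adj (LA X) + 1 *\<^sub>R adj (LS X))"
    by simp
  then show ?thesis
    by (simp add: scaleR_2)
qed

text \<open>Dividing the minimum principle for \<open>LA + \<gamma> LS\<close> by \<open>\<gamma>\<close> and letting \<open>\<gamma>\<close> tend to infinity.\<close>

lemma symmetric_part_minimum_principle:
  assumes qms: "\<And>\<gamma>. \<gamma> > 0 \<Longrightarrow> qms_generator M (lift_generator LA LS \<gamma>)" and X: "X \<in> M"
    and psd: "psd (X - r *\<^sub>R mat 1)" and v: "v \<bullet> (X *v v) = r * (v \<bullet> v)"
  shows "0 \<le> v \<bullet> (LS X *v v)"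
proof (rule ccontr)
  define a b where "a = v \<bullet> (LA X *v v)" and "b = v \<bullet> (LS X *v v)"
  assume "\<not> 0 \<le> v \<bullet> (LS X *v v)"
  then have b: "b < 0"
    by (simp add: b_def)
  have *: "0 \<le> a + \<gamma> * b" if "\<gamma> > 0" for \<gamma>
    using qms_generator_minimum_principle[OF vna qms[OF that] X psd v]
    by (simp add: lift_generator_def a_def b_def matrix_vector_mult_add_rdistrib scaleR_mult_vec inner_add_right)
  \<comment> \<open>a value of \<open>\<gamma>\<close> so large that the term with \<open>LS\<close> dominates\<close>
  have "((\<bar>a\<bar> + 1) / (- b)) * b = - (\<bar>a\<bar> + 1)"
    using b by simp
  moreover have "(\<bar>a\<bar> + 1) / (- b) > 0"
    using b by (intro divide_pos_pos) auto
  ultimately show False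
    using *[of "(\<bar>a\<bar> + 1) / (- b)"] by linarith
qed

text \<open>A lowest eigenvector of \<open>- LS\<close> can be chosen self-adjoint, as \<open>LS\<close> commutes with the adjoint.  If
  the eigenvalue \<open>- r\<close> of \<open>LS\<close> were positive, the minimum principle would force the minima of the
  quadratic forms of the eigenvector \<open>H\<close> and of \<open>- H\<close> to be nonnegative, hence \<open>H = 0\<close>.\<close>

lemma symmetric_part_nonpos:
  assumes LA: "linear_map M M LA" and LS: "linear_map M M LS"
    and qms: "\<And>\<gamma>. \<gamma> > 0 \<Longrightarrow> qms_generator M (lift_generator LA LS \<gamma>)"
    and sa: "\<And>X Y. X \<in> M \<Longrightarrow> Y \<in> M \<Longrightarrow> J (LS X) \<bullet> J Y = J X \<bullet> J (LS Y)"
    and X: "X \<in> M"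
  shows "J X \<bullet> J (LS X) \<le> 0"
proof -
  note lin = linear_mapD[OF LS]
  obtain T where T: "linear T" "\<And>X. X \<in> M \<Longrightarrow> T X = LS X"
    using linear_map_extension[OF M_sub LS] by blast
  define nT where "nT X = - T X" for X
  have nT: "linear nT"
    unfolding nT_def[abs_def] using T(1) by (rule linear_compose_neg)
  have sym: "J (nT X) \<bullet> J Y = J X \<bullet> J (nT Y)" if "X \<in> M" "Y \<in> M" for X Y
    using sa[OF that] that T(2) by (simp add: nT_def linear_neg[OF linear_J])
  have "(mat 1 :: 'n cmat) \<noteq> 0"
    by (simp add: vec_eq_iff mat_def)
  then have "M \<noteq> {0}"
    using M_one by blast
  then obtain x r where x: "x \<in> M" "x \<noteq> 0" "\<And>y. y \<in> M \<Longrightarrow> J y \<bullet> J (nT x) = r * (J y \<bullet> J x)"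
    "\<And>y. y \<in> M \<Longrightarrow> r * (J y \<bullet> J y) \<le> J y \<bullet> J (nT y)"
    using rayleigh_minimizer[OF linear_J inj_J nT M_real_sub _ sym] by blast
  have "nT x = r *\<^sub>R x"
  proof (rule J_eqI[OF M_real_sub])
    have "LS x \<in> M"
      using lin(1) x(1) .
    then show "nT x \<in> M" "r *\<^sub>R x \<in> M"
      using x(1) T(2) M_real_sub by (simp_all add: nT_def subspace_neg subspace_scale)
    show "J z \<bullet> J (nT x - r *\<^sub>R x) = 0" if "z \<in> M" for z
      using x(3)[OF that] by (simp add: linear_diff[OF linear_J] linear_scale[OF linear_J] inner_diff_right)
  qed
  then have ev: "LS x = (- r) *\<^sub>R x"
    using T(2)[OF x(1)] by (simp add: nT_def minus_equation_iff[of "LS x"])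
  have "0 \<le> r"
  proof (rule ccontr)
    assume r: "\<not> 0 \<le> r"
    note ax = M_adj[OF x(1)]
    have eva: "LS (adj x) = (- r) *\<^sub>R adj x"
      using symmetric_part_adj[OF LA LS qms x(1)] ev adj_scaleR[of "- r" x] by simp
    obtain H where H: "H \<in> M" "adj H = H" "H \<noteq> 0" "LS H = (- r) *\<^sub>R H"
    proof (cases "x + adj x = 0")
      case True
      then have a: "adj x = - x"
        by (simp add: eq_neg_iff_add_eq_0 add.commute)
      show ?thesis
      proof (rule that)
        show "cscale \<i> x \<in> M"
          using M_sub x(1) by (rule cmat.subspace_scale)
        show "adj (cscale \<i> x) = cscale \<i> x"
          by (simp add: adj_cscale a)
        show "cscale \<i> x \<noteq> 0"
          using x(2) by (simp add: cmat.scale_eq_0_iff)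
        show "LS (cscale \<i> x) = (- r) *\<^sub>R cscale \<i> x"
          using lin(3)[OF x(1), of \<i>] ev linear_scale[OF linear_cscale, of \<i> "- r" x] by simp
      qed
    next
      case False
      show ?thesis
      proof (rule that)
        show "x + adj x \<in> M"
          using M_real_sub x(1) ax by (rule subspace_add)
        show "adj (x + adj x) = x + adj x"
          by (simp add: adj_add add.commute)
        show "x + adj x \<noteq> 0"
          by (rule False)
        show "LS (x + adj x) = (- r) *\<^sub>R (x + adj x)"
          unfolding lin(2)[OF x(1) ax] ev eva scaleR_add_right ..
      qed
    qed
    have nonneg: "0 \<le> w \<bullet> (K *v w)" if K: "K \<in> M" "adj K = K" "LS K = (- r) *\<^sub>R K" for K w
    proof -
      have nz: "(UNIV :: (complex ^ 'n) set) \<noteq> {0}"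
        using UNIV_not_singleton by blast
      have sym: "id (K *v u) \<bullet> id v = id u \<bullet> id (K *v v)" for u v
        using inner_adj_mult_vec[of K u v] K(2) by simp
      obtain v s where v: "v \<noteq> 0" "\<And>y. id y \<bullet> id (K *v v) = s * (id y \<bullet> id v)"
        "\<And>y. s * (id y \<bullet> id y) \<le> id y \<bullet> id (K *v y)"
        using rayleigh_minimizer[OF linear_id inj_on_id linear_mult_vec[of K] subspace_UNIV nz sym]
        by (metis UNIV_I)
      have "psd (K - s *\<^sub>R mat 1)"
        using v(3) K(2) by (simp add: psd_iff adj_diff adj_scaleR matrix_vector_mult_diff_rdistrib
            scaleR_mult_vec inner_diff_right)
      then have "0 \<le> v \<bullet> (LS K *v v)"
        using v(2)[of v] by (intro symmetric_part_minimum_principle[OF qms K(1)]) auto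
      also have "\<dots> = (- r) * (s * (v \<bullet> v))"
        using v(2)[of v] by (simp add: K(3) scaleR_mult_vec del: scaleR_minus_left)
      finally have "0 \<le> (- r) * (s * (v \<bullet> v))" .
      then have "0 \<le> s * (v \<bullet> v)"
        using r by (simp add: mult_le_0_iff)
      then have "0 \<le> s"
        using v(1) mult_neg_pos[of s "v \<bullet> v"] inner_gt_zero_iff[of v] by linarith
      then have "0 \<le> s * (w \<bullet> w)"
        by simp
      then show ?thesis
        using v(3)[of w] by simp
    qed
    have nH: "- H \<in> M" "adj (- H) = - H" "LS (- H) = (- r) *\<^sub>R (- H)"
      using H lin(4)[OF H(1), of "-1"] M_real_sub adj_scaleR[of "-1" H] by (simp_all add: subspace_neg)
    have "cip w (H *v w) = 0" for w
    proof -
      have "w \<bullet> (H *v w) = 0"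
        using nonneg[OF H(1,2,4), of w] nonneg[OF nH, of w]
        by (simp add: linear_neg[OF linear_mult_vec_left])
      moreover have "cip w (H *v w) \<in> \<real>"
        using H(2) adj_eq_self_iff_real_quadratic_form by blast
      ultimately show ?thesis
        by (simp add: inner_vec_eq_Re_cip complex_is_Real_iff complex_eq_iff)
    qed
    then have "H = 0"
      by (rule cmat_eq_0_if_quadratic_form_0)
    then show False
      using H(3) by simp
  qed
  then have "0 \<le> r * (J X \<bullet> J X)"
    by simp
  then show ?thesis
    using x(4)[OF X] T(2)[OF X] by (simp add: nT_def linear_neg[OF linear_J])
qed

end

section \<open>The overdamped generator\<close>

text \<open>The hypotheses on a second-order lift in the form in which they enter: the two adjointness
  relations are stated for the real part of the KMS inner product.\<close>

locale hypocoercive_pair = faithful_vna \<sigma> M for \<sigma> :: "'n::finite cmat" and M +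
  fixes LA LS ES :: "'n cmat \<Rightarrow> 'n cmat"
  assumes LA: "linear_map M M LA" and LS: "linear_map M M LS"
    and LA_antisym: "\<And>X Y. X \<in> M \<Longrightarrow> Y \<in> M \<Longrightarrow> J (LA X) \<bullet> J Y = - (J X \<bullet> J (LA Y))"
    and LS_sym: "\<And>X Y. X \<in> M \<Longrightarrow> Y \<in> M \<Longrightarrow> J (LS X) \<bullet> J Y = J X \<bullet> J (LS Y)"
    and qms: "\<And>\<gamma>. \<gamma> > 0 \<Longrightarrow> qms_generator M (lift_generator LA LS \<gamma>)"
    and ES: "conditional_expectation \<sigma> M (ker_on M LS) ES"
    and ES_LA_ES: "\<And>X. X \<in> M \<Longrightarrow> ES (LA (ES X)) = 0"
begin

abbreviation "N \<equiv> ker_on M LS"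
abbreviation "F \<equiv> {X\<in>M. LA X = 0 \<and> LS X = 0}"
abbreviation "K \<equiv> (LA \<circ> ES) ` M"
abbreviation "G \<equiv> kms_pinv \<sigma> M (\<lambda>Y. - LS Y)"
abbreviation "LO \<equiv> overdamped_generator \<sigma> M LA LS ES"

lemma J_diff: "J (X - Y) = J X - J Y" and J_add: "J (X + Y) = J X + J Y"
  and J_neg: "J (- X) = - J X" and J_scale: "J (r *\<^sub>R X) = r *\<^sub>R J X" and J_0 [simp]: "J 0 = 0"
  using linear_J by (auto simp: linear_diff linear_add linear_neg linear_scale linear_0)

lemmas LA_lin = linear_mapD[OF LA] and LS_lin = linear_mapD[OF LS]

lemma NM: "N \<subseteq> M"
  by (auto simp: ker_on_def)

lemmas N_sub' = N_sub[OF ES NM]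
lemmas N_real_sub = complex_subspace_imp_subspace[OF N_sub']

lemma LS_nonpos: "X \<in> M \<Longrightarrow> J X \<bullet> J (LS X) \<le> 0"
  using symmetric_part_nonpos[OF LA LS qms LS_sym] by blast

text \<open>A vector on which a semidefinite form vanishes lies in its radical.\<close>

lemma LS_eq_0I:
  assumes X: "X \<in> M" and 0: "J X \<bullet> J (LS X) = 0"
  shows "LS X = 0"
proof -
  have "J Y \<bullet> J (LS X) = 0" if Y: "Y \<in> M" for Y
  proof -
    have "0 \<le> 2 * t * (- (J Y \<bullet> J (LS X))) + t\<^sup>2 * (- (J Y \<bullet> J (LS Y)))" for t
    proof -
      have tY: "t *\<^sub>R Y \<in> M"
        using M_real_sub Y by (rule subspace_scale)
      have "J (X + t *\<^sub>R Y) \<bullet> J (LS (X + t *\<^sub>R Y)) \<le> 0"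
        using X tY M_real_sub by (intro LS_nonpos subspace_add)
      moreover have "J X \<bullet> J (LS Y) = J Y \<bullet> J (LS X)"
        using LS_sym[OF X Y] by (simp add: inner_commute)
      ultimately show ?thesis
        using 0 by (simp add: LS_lin(2)[OF X tY] LS_lin(4)[OF Y] J_add J_scale inner_add_left
            inner_add_right power2_eq_square algebra_simps)
    qed
    then have "- (J Y \<bullet> J (LS X)) = 0"
      by (rule nonneg_quadratic_linear_coeff)
    then show ?thesis
      by simp
  qed
  then show ?thesis
    using LS_lin(1)[OF X] M_real_sub by (intro J_eqI[of M]) (auto simp: subspace_0)
qed

text \<open>The antisymmetric part drops out of \<open>\<langle>X, L X\<rangle>\<close>, so an element of the kernel of \<open>L\<close> is already
  annihilated by \<open>LS\<close>, and then by \<open>LA\<close>.\<close>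

lemma ker_lift_generator:
  assumes "\<gamma> > 0"
  shows "ker_on M (lift_generator LA LS \<gamma>) = F"
proof -
  have "LA X = 0 \<and> LS X = 0" if X: "X \<in> M" and 0: "LA X + \<gamma> *\<^sub>R LS X = 0" for X
  proof -
    have "J X \<bullet> J (LA X) = 0"
      using LA_antisym[OF X X] by (simp add: inner_commute)
    moreover have "J X \<bullet> J (LA X + \<gamma> *\<^sub>R LS X) = 0"
      by (simp add: 0)
    ultimately have "J X \<bullet> J (LS X) = 0"
      using assms by (simp add: J_add J_scale inner_add_right)
    then have "LS X = 0"
      by (rule LS_eq_0I[OF X])
    then show ?thesis
      using 0 by simp
  qed
  then show ?thesis
    by (auto simp: ker_on_def lift_generator_def)
qed

lemma ES_in_N: "X \<in> M \<Longrightarrow> ES X \<in> N"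
  using E_lin(1)[OF ES NM] .

lemma ES_id: "X \<in> N \<Longrightarrow> ES X = X"
  using E_id[OF ES NM] .

lemma LA_ES: "linear_map M M (LA \<circ> ES)"
proof -
  have "ES X \<in> M" if "X \<in> M" for X
    using ES_in_N[OF that] NM by blast
  then show ?thesis
    using E_lin(2,3)[OF ES NM] LA_lin unfolding linear_map_def by simp
qed

lemma K_eq: "K = LA ` N"
proof
  show "K \<subseteq> LA ` N"
    using ES_in_N by auto
  show "LA ` N \<subseteq> K"
  proof
    fix Y assume "Y \<in> LA ` N"
    then obtain X where X: "X \<in> N" "Y = LA X" by blast
    then have "Y = (LA \<circ> ES) X" "X \<in> M"
      using ES_id NM by auto
    then show "Y \<in> K" by blast
  qed
qed

lemma linear_image_complex_subspace:
  assumes "linear_map M M \<Phi>"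
  shows "cmat.subspace (\<Phi> ` M)"
  unfolding cmat.subspace_def
proof (intro conjI ballI allI)
  note lin = linear_mapD[OF assms]
  have "\<Phi> 0 = 0"
    using lin(4)[OF M_one, of 0] by simp
  then show "0 \<in> \<Phi> ` M"
    using cmat.subspace_0[OF M_sub] by (metis imageI)
  show "x + y \<in> \<Phi> ` M" if "x \<in> \<Phi> ` M" "y \<in> \<Phi> ` M" for x y
    using that lin(2) cmat.subspace_add[OF M_sub] by (auto simp flip: lin(2))
  show "cscale c x \<in> \<Phi> ` M" if "x \<in> \<Phi> ` M" for c x
    using that cmat.subspace_scale[OF M_sub] by (auto simp flip: lin(3))
qed

lemmas K_sub = linear_image_complex_subspace[OF LA_ES]
lemmas K_real_sub = complex_subspace_imp_subspace[OF K_sub]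

lemma KM: "K \<subseteq> M"
  using linear_mapD(1)[OF LA_ES] by auto

definition N_perp where "N_perp = {Y\<in>M. \<forall>Z\<in>N. J Z \<bullet> J Y = 0}"

text \<open>This is what the condition \<open>ES LA ES = 0\<close> says once \<open>ES\<close> is known to be the orthogonal
  projection onto \<open>N\<close>.\<close>

lemma K_perp: "K \<subseteq> N_perp"
proof
  fix Y assume "Y \<in> K"
  then obtain X where X: "X \<in> M" "Y = LA (ES X)" by auto
  have Y: "Y \<in> M"
    using KM \<open>Y \<in> K\<close> by blast
  have "J Z \<bullet> J Y = 0" if "Z \<in> N" for Z
    using conditional_expectation_kms_orthogonal[OF ES NM that Y] ES_LA_ES[OF X(1)] X(2) by simp
  then show "Y \<in> N_perp"
    using Y by (simp add: N_perp_def)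
qed

lemma N_perp_sub: "subspace N_perp"
  using M_real_sub by (auto simp: N_perp_def subspace_def J_add J_scale J_0 inner_add_right)

lemma LS_inj_on_N_perp:
  assumes "X \<in> N_perp" "Y \<in> N_perp" "LS X = LS Y"
  shows "X = Y"
proof -
  have X: "X \<in> M" and Y: "Y \<in> M"
    using assms by (auto simp: N_perp_def)
  have nY: "(-1) *\<^sub>R Y \<in> M"
    using M_real_sub Y by (rule subspace_scale)
  have d: "X - Y \<in> N_perp"
    using N_perp_sub assms by (simp add: subspace_diff)
  have "LS (X - Y) = LS X - LS Y"
    using LS_lin(2)[OF X nY] LS_lin(4)[OF Y, of "-1"] by simp
  then have "X - Y \<in> N"
    using d assms(3) by (auto simp: ker_on_def N_perp_def)
  then have "J (X - Y) \<bullet> J (X - Y) = 0"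
    using d by (auto simp: N_perp_def)
  then show ?thesis
    by simp
qed

lemma minus_LS: "linear_map M M (\<lambda>Y. - LS Y)"
proof -
  have "- LS X = cscale (-1) (LS X)" for X
    by simp
  then show ?thesis
    using LS_lin M_real_sub linear_scale[OF linear_cscale, of _ "-1"] unfolding linear_map_def
    by (auto simp: subspace_neg)
qed

lemmas range_sub = linear_image_complex_subspace[OF minus_LS]

text \<open>A self-adjoint operator maps the orthogonal complement of its kernel bijectively onto itself, so
  there the pseudoinverse is an inverse.\<close>

lemma pinv:
  assumes Y: "Y \<in> N_perp"
  shows "G Y \<in> N_perp" "- LS (G Y) = Y"
proof -
  let ?V = "(\<lambda>Y. - LS Y) ` M"
  have YM: "Y \<in> M"
    using Y by (simp add: N_perp_def)
  have VM: "?V \<subseteq> M"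
    using linear_mapD(1)[OF minus_LS] by auto
  have V_perp: "J Z \<bullet> J X = 0" if X: "X \<in> ?V" and Z: "Z \<in> N" for X Z
  proof -
    obtain W where W: "W \<in> M" "X = - LS W" using X by blast
    show ?thesis
      using LS_sym[of Z W] Z W by (simp add: J_neg ker_on_def)
  qed
  define Y1 where "Y1 = kms_proj \<sigma> ?V Y"
  have Y1: "Y1 \<in> ?V" "\<And>Z. Z \<in> ?V \<Longrightarrow> J Z \<bullet> J (Y - Y1) = 0"
    using kms_proj[OF range_sub] by (auto simp: Y1_def)
  have dM: "Y - Y1 \<in> M"
    using M_real_sub YM subsetD[OF VM Y1(1)] by (rule subspace_diff)
  have "J (LS (Y - Y1)) \<bullet> J (Y - Y1) = 0"
    using Y1(2)[of "- LS (Y - Y1)"] dM by (simp add: J_neg)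
  then have "LS (Y - Y1) = 0"
    using LS_eq_0I[OF dM] by (simp add: inner_commute)
  then have dN: "Y - Y1 \<in> N"
    using dM by (simp add: ker_on_def)
  have "J (Y - Y1) \<bullet> J Y = 0"
    using Y dN by (simp add: N_perp_def)
  moreover have "J (Y - Y1) \<bullet> J Y1 = 0"
    using V_perp[OF Y1(1) dN] .
  ultimately have "J (Y - Y1) \<bullet> J (Y - Y1) = 0"
    by (simp add: J_diff inner_diff_right)
  then have YV: "Y = Y1"
    by simp
  then obtain W where W: "W \<in> M" "Y = - LS W"
    using Y1(1) by blast
  have pY: "kms_proj \<sigma> ?V Y = Y"
    using YV[symmetric] by (simp only: Y1_def)
  obtain W0 where W0: "W0 \<in> N" "\<And>Z. Z \<in> N \<Longrightarrow> J Z \<bullet> J (W - W0) = 0"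
    using subspace_projection_exists[OF linear_J N_real_sub] by blast
  have W0M: "W0 \<in> M"
    using W0(1) NM by blast
  have nW0: "(-1) *\<^sub>R W0 \<in> M"
    using M_real_sub W0M by (rule subspace_scale)
  have D: "W - W0 \<in> N_perp"
    using W0(2) W(1) W0M M_real_sub by (simp add: N_perp_def subspace_diff)
  have "LS (W - W0) = LS W"
    using LS_lin(2)[OF W(1) nW0] LS_lin(4)[OF W0M, of "-1"] W0(1) by (simp add: ker_on_def)
  then have WD: "- LS (W - W0) = Y"
    using W(2) by simp
  have ker: "ker_on M (\<lambda>Y. - LS Y) = N"
    by (auto simp: ker_on_def)
  have perp: "(\<forall>Z\<in>N. kms_ip \<sigma> Z X = 0) \<longleftrightarrow> (\<forall>Z\<in>N. J Z \<bullet> J X = 0)" for X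
    using kms_ip_eq_0I[OF N_sub'] by (auto simp flip: Re_kms_ip)
  have "G Y = W - W0"
    unfolding kms_pinv_def ker
  proof (rule the_equality)
    show "W - W0 \<in> M \<and> (\<forall>Z\<in>N. kms_ip \<sigma> Z (W - W0) = 0) \<and> - LS (W - W0) = kms_proj \<sigma> ?V Y"
      unfolding perp pY using D WD by (simp add: N_perp_def)
  next
    fix X assume "X \<in> M \<and> (\<forall>Z\<in>N. kms_ip \<sigma> Z X = 0) \<and> - LS X = kms_proj \<sigma> ?V Y"
    then have X: "X \<in> N_perp" "- LS X = Y"
      unfolding perp pY by (simp_all add: N_perp_def)
    show "X = W - W0"
      using X(2) WD by (intro LS_inj_on_N_perp[OF X(1) D]) (metis neg_equal_iff_equal)
  qed
  then show "G Y \<in> N_perp" "- LS (G Y) = Y"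
    using D WD by auto
qed

lemma pinv_symmetric:
  assumes X: "X \<in> N_perp" and Y: "Y \<in> N_perp"
  shows "J (G X) \<bullet> J Y = J X \<bullet> J (G Y)"
proof -
  have GX: "G X \<in> M" and GY: "G Y \<in> M"
    using pinv(1)[OF X] pinv(1)[OF Y] by (auto simp: N_perp_def)
  have "J (G X) \<bullet> J (- LS (G Y)) = J (- LS (G X)) \<bullet> J (G Y)"
    using LS_sym[OF GX GY] by (simp add: J_neg)
  then show ?thesis
    by (simp only: pinv(2)[OF X] pinv(2)[OF Y])
qed

text \<open>With \<open>W = G Y\<close> one has \<open>\<langle>Y, G Y\<rangle> = - \<langle>W, LS W\<rangle>\<close>, which is nonnegative and vanishes only if
  \<open>Y = - LS W\<close> does.\<close>

lemma pinv_positive: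
  assumes Y: "Y \<in> N_perp" and "Y \<noteq> 0"
  shows "J Y \<bullet> J (G Y) > 0"
proof -
  have GY: "G Y \<in> M"
    using pinv(1)[OF Y] by (simp add: N_perp_def)
  have e: "J Y \<bullet> J (G Y) = - (J (G Y) \<bullet> J (LS (G Y)))"
    using arg_cong[OF pinv(2)[OF Y], of "\<lambda>Z. J Z \<bullet> J (G Y)"] by (simp add: J_neg inner_commute)
  then have "J Y \<bullet> J (G Y) \<ge> 0"
    using LS_nonpos[OF GY] by simp
  moreover have "J Y \<bullet> J (G Y) \<noteq> 0"
    using e LS_eq_0I[OF GY] pinv(2)[OF Y] assms(2) by auto
  ultimately show ?thesis
    by simp
qed

lemma pinv_linear:
  assumes X: "X \<in> N_perp" and Y: "Y \<in> N_perp"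
  shows "G (X + Y) = G X + G Y" "G (r *\<^sub>R X) = r *\<^sub>R G X"
proof -
  have M: "G X \<in> M" "G Y \<in> M"
    using pinv(1)[OF X] pinv(1)[OF Y] by (auto simp: N_perp_def)
  have XY: "X + Y \<in> N_perp" and rX: "r *\<^sub>R X \<in> N_perp"
    using N_perp_sub X Y by (auto simp: subspace_add subspace_scale)
  have "- LS (G (X + Y)) = - LS (G X) + - LS (G Y)"
    by (simp only: pinv(2)[OF X] pinv(2)[OF Y] pinv(2)[OF XY])
  then have "LS (G (X + Y)) = LS (G X) + LS (G Y)"
    by (metis neg_equal_iff_equal minus_add_distrib)
  then have "LS (G (X + Y)) = LS (G X + G Y)"
    by (simp only: LS_lin(2)[OF M])
  then show "G (X + Y) = G X + G Y"
    by (rule LS_inj_on_N_perp[OF pinv(1)[OF XY] subspace_add[OF N_perp_sub pinv(1)[OF X] pinv(1)[OF Y]]])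
  have "- LS (G (r *\<^sub>R X)) = r *\<^sub>R (- LS (G X))"
    by (simp only: pinv(2)[OF X] pinv(2)[OF rX])
  then have "LS (G (r *\<^sub>R X)) = LS (r *\<^sub>R G X)"
    by (simp add: LS_lin(4)[OF M(1)])
  then show "G (r *\<^sub>R X) = r *\<^sub>R G X"
    by (rule LS_inj_on_N_perp[OF pinv(1)[OF rX] subspace_scale[OF N_perp_sub pinv(1)[OF X]]])
qed

lemma compression_eigenvector:
  assumes "r \<noteq> 0" and "eigenvalue_on M (kms_proj \<sigma> K \<circ> G \<circ> kms_proj \<sigma> K) (complex_of_real r)"
  obtains X where "X \<in> K" "X \<noteq> 0" "\<And>Z. Z \<in> K \<Longrightarrow> J Z \<bullet> J (G X) = r * (J Z \<bullet> J X)"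
proof -
  obtain X where X: "X \<in> M" "X \<noteq> 0" "kms_proj \<sigma> K (G (kms_proj \<sigma> K X)) = r *\<^sub>R X"
    using assms(2) by (auto simp: eigenvalue_on_def cscale_of_real)
  have "(1 / r) *\<^sub>R (r *\<^sub>R X) \<in> K"
    unfolding X(3)[symmetric] by (rule subspace_scale[OF K_real_sub kms_proj(1)[OF K_sub]])
  then have XK: "X \<in> K"
    using assms(1) by simp
  then have "kms_proj \<sigma> K (G X) = r *\<^sub>R X"
    using X(3) kms_proj_ident[OF K_sub XK] by simp
  then have "J Z \<bullet> J (G X) = r * (J Z \<bullet> J X)" if "Z \<in> K" for Z
    using kms_proj(2)[OF K_sub that, of "G X"] by (simp add: J_diff J_scale inner_diff_right)
  then show ?thesis
    using that XK X(2) by blast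
qed

text \<open>On \<open>K\<close> the form \<open>\<langle>Y, G Y\<rangle>\<close> is positive definite, so all nonzero eigenvalues of the compression
  are positive.  The minimum of the Rayleigh quotient over \<open>K\<close> is one of them, and hence an upper
  bound for the minimal one.  Finiteness of the set of eigenvalues makes its minimum meaningful.\<close>

lemma min_eigenvalue_compression:
  assumes K: "K \<noteq> {0}"
  shows "min_eigenvalue_compression \<sigma> M LA LS ES > 0"
    and "Y \<in> K \<Longrightarrow> min_eigenvalue_compression \<sigma> M LA LS ES * (J Y \<bullet> J Y) \<le> J Y \<bullet> J (G Y)"
proof -
  define R where "R = {r::real. r \<noteq> 0 \<and>
      eigenvalue_on M (kms_proj \<sigma> K \<circ> G \<circ> kms_proj \<sigma> K) (complex_of_real r)}"
  have s_eq: "min_eigenvalue_compression \<sigma> M LA LS ES = Min R"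
    by (simp add: min_eigenvalue_compression_def R_def Let_def)
  have ex: "\<exists>X. X \<in> K \<and> X \<noteq> 0 \<and> (\<forall>Z\<in>K. J Z \<bullet> J (G X) = r * (J Z \<bullet> J X))" if "r \<in> R" for r
  proof -
    have "r \<noteq> 0" "eigenvalue_on M (kms_proj \<sigma> K \<circ> G \<circ> kms_proj \<sigma> K) (complex_of_real r)"
      using that unfolding R_def by blast+
    then obtain X where "X \<in> K" "X \<noteq> 0" "\<And>Z. Z \<in> K \<Longrightarrow> J Z \<bullet> J (G X) = r * (J Z \<bullet> J X)"
      by (rule compression_eigenvector) (rule that)
    then show ?thesis
      by blast
  qed
  have R_pos: "r > 0" if r: "r \<in> R" for r
  proof -
    obtain X where X: "X \<in> K" "X \<noteq> 0" "J X \<bullet> J (G X) = r * (J X \<bullet> J X)"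
      using ex[OF r] by blast
    then have "0 < r * (J X \<bullet> J X)"
      using pinv_positive[of X] K_perp by auto
    then show ?thesis
      using inner_ge_zero[of "J X"] by (auto simp: zero_less_mult_iff)
  qed
  define x where "x r = (SOME X. X \<in> K \<and> X \<noteq> 0 \<and> (\<forall>Z\<in>K. J Z \<bullet> J (G X) = r * (J Z \<bullet> J X)))" for r
  have x: "x r \<in> K \<and> x r \<noteq> 0 \<and> (\<forall>Z\<in>K. J Z \<bullet> J (G (x r)) = r * (J Z \<bullet> J (x r)))" if "r \<in> R" for r
    unfolding x_def by (rule someI_ex[OF ex[OF that]])
  have fin: "finite R"
  proof (rule orthogonal_family_finite[of R J x])
    show "J (x r) \<noteq> 0" if "r \<in> R" for r
      using x[OF that] by simp
    show "J (x r) \<bullet> J (x s) = 0" if r: "r \<in> R" and s: "s \<in> R" and ne: "r \<noteq> s" for r s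
    proof -
      have "J (x r) \<bullet> J (G (x s)) = s * (J (x r) \<bullet> J (x s))"
        using x r s by blast
      moreover have "J (x s) \<bullet> J (G (x r)) = r * (J (x s) \<bullet> J (x r))"
        using x r s by blast
      moreover have "J (G (x r)) \<bullet> J (x s) = J (x r) \<bullet> J (G (x s))"
        using x r s K_perp by (intro pinv_symmetric) auto
      ultimately have "s * (J (x r) \<bullet> J (x s)) = r * (J (x r) \<bullet> J (x s))"
        by (metis inner_commute)
      then show ?thesis
        using ne by auto
    qed
  qed
  have Kp: "\<And>X. X \<in> K \<Longrightarrow> X \<in> N_perp"
    using K_perp by blast
  obtain g where g: "linear g" "\<And>X. X \<in> K \<Longrightarrow> g X = G X"
    using linear_extension[OF K_real_sub, of G] pinv_linear Kp by metis
  have g_sym: "J (g X) \<bullet> J Y = J X \<bullet> J (g Y)" if "X \<in> K" "Y \<in> K" for X Y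
    using pinv_symmetric[OF Kp Kp] that g(2) by metis
  obtain X r where X: "X \<in> K" "X \<noteq> 0" "\<And>Y. Y \<in> K \<Longrightarrow> J Y \<bullet> J (g X) = r * (J Y \<bullet> J X)"
    "\<And>Y. Y \<in> K \<Longrightarrow> r * (J Y \<bullet> J Y) \<le> J Y \<bullet> J (g Y)"
    using rayleigh_minimizer[OF linear_J inj_J g(1) K_real_sub K g_sym] by blast
  have "r \<in> R"
  proof -
    have "0 < r * (J X \<bullet> J X)"
      using X(3)[OF X(1)] pinv_positive[OF Kp[OF X(1)] X(2)] g(2)[OF X(1)] by simp
    then have "r \<noteq> 0"
      by auto
    moreover have "kms_proj \<sigma> K (G X) = r *\<^sub>R X"
    proof (rule kms_proj_eqI[OF K_sub])
      show "r *\<^sub>R X \<in> K"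
        using K_real_sub X(1) by (rule subspace_scale)
      show "J Z \<bullet> J (G X - r *\<^sub>R X) = 0" if "Z \<in> K" for Z
        using X(3)[OF that] g(2)[OF X(1)] by (simp add: J_diff J_scale inner_diff_right)
    qed
    then have "(kms_proj \<sigma> K \<circ> G \<circ> kms_proj \<sigma> K) X = cscale (complex_of_real r) X"
      using kms_proj_ident[OF K_sub X(1)] by (simp add: cscale_of_real)
    ultimately show ?thesis
      using X(1,2) KM unfolding R_def eigenvalue_on_def by blast
  qed
  then have "Min R \<in> R" "Min R \<le> r"
    using fin by (auto intro: Min_in)
  then show "min_eigenvalue_compression \<sigma> M LA LS ES > 0"
    using R_pos s_eq by simp
  show "min_eigenvalue_compression \<sigma> M LA LS ES * (J Y \<bullet> J Y) \<le> J Y \<bullet> J (G Y)" if Y: "Y \<in> K"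
    using X(4)[OF Y] g(2)[OF Y] mult_right_mono[OF \<open>Min R \<le> r\<close>, of "J Y \<bullet> J Y"] s_eq by simp
qed

lemma overdamped_form:
  assumes A: "A \<in> N" and X: "X \<in> N"
  shows "J A \<bullet> J (LO X) = - (J (LA A) \<bullet> J (G (LA X)))"
proof -
  have "J ((LA \<circ> ES) A) \<bullet> J (G (LA (ES X))) = J A \<bullet> J (kms_adjoint \<sigma> M (LA \<circ> ES) (G (LA (ES X))))"
    using A NM by (intro kms_adjoint(2)[OF M_sub LA_ES]) auto
  then show ?thesis
    by (simp add: overdamped_generator_def J_neg ES_id[OF A] ES_id[OF X])
qed

text \<open>By positivity of the pseudoinverse, \<open>\<langle>X, LO X\<rangle>\<close> vanishes only if \<open>LA X\<close> does; thus the overdamped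
  and the lifted dynamics have the same fixed points.\<close>

lemma ker_overdamped: "ker_on N LO = F"
proof
  show "ker_on N LO \<subseteq> F"
  proof
    fix X assume "X \<in> ker_on N LO"
    then have X: "X \<in> N" "LO X = 0"
      by (auto simp: ker_on_def)
    have "J (LA X) \<bullet> J (G (LA X)) = 0"
      using overdamped_form[OF X(1) X(1)] X(2) by simp
    moreover have "LA X \<in> N_perp"
      using K_perp K_eq X(1) by blast
    ultimately have "LA X = 0"
      using pinv_positive[of "LA X"] by force
    then show "X \<in> F"
      using X(1) by (auto simp: ker_on_def)
  qed
  show "F \<subseteq> ker_on N LO"
  proof
    fix X assume "X \<in> F"
    then have X: "X \<in> N" "LA X = 0"
      by (auto simp: ker_on_def)
    have 0: "0 \<in> N_perp"
      using N_perp_sub by (rule subspace_0)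
    have "G 0 = 0"
      using pinv_linear(2)[OF 0 0, of 0] by simp
    have "kms_adjoint \<sigma> M (LA \<circ> ES) 0 = 0"
    proof (rule J_eqI[OF M_real_sub])
      show "kms_adjoint \<sigma> M (LA \<circ> ES) 0 \<in> M"
        by (rule kms_adjoint(1)[OF M_sub LA_ES])
      show "0 \<in> M"
        using M_real_sub by (rule subspace_0)
      show "J Z \<bullet> J (kms_adjoint \<sigma> M (LA \<circ> ES) 0 - 0) = 0" if "Z \<in> M" for Z
        using kms_adjoint(2)[OF M_sub LA_ES that, of 0] by (simp add: J_0)
    qed
    then have "LO X = 0"
      using X \<open>G 0 = 0\<close> by (simp add: overdamped_generator_def ES_id)
    then show "X \<in> ker_on N LO"
      using X(1) by (simp add: ker_on_def)
  qed
qed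

end

section \<open>Slow observables and the two bounds\<close>

context hypocoercive_pair
begin

context
  fixes \<gamma> :: real and EF EO :: "'n cmat \<Rightarrow> 'n cmat"
  assumes \<gamma>: "\<gamma> > 0"
    and EF: "conditional_expectation \<sigma> M F EF" and EO: "conditional_expectation \<sigma> M F EO"
begin

abbreviation "L \<equiv> lift_generator LA LS \<gamma>"
abbreviation "s_min \<equiv> min_eigenvalue_compression \<sigma> M LA LS ES"

lemma FM: "F \<subseteq> M"
  by blast

lemma L_linear_map: "linear_map M M L"
  using qms[OF \<gamma>] by (simp add: qms_generator_def)

lemma L_dissipative: "X \<in> M \<Longrightarrow> J X \<bullet> J (L X) \<le> 0"
  using LA_antisym[of X X] LS_nonpos[of X] \<gamma>
  by (simp add: lift_generator_def J_add J_scale inner_add_right inner_commute mult_nonneg_nonpos)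

text \<open>The range of \<open>L\<close> is orthogonal to \<open>F\<close>, because \<open>F\<close> is also the kernel of the adjoint
  \<open>- LA + \<gamma> LS\<close>.  So the velocity \<open>L Y\<close> of an observable has mean zero and is itself subject to
  the decay hypothesis.\<close>

lemma EF_lift_generator:
  assumes Z: "Z \<in> M"
  shows "EF (L Z) = 0"
proof (rule J_eqI)
  note F_sub = complex_subspace_imp_subspace[OF N_sub[OF EF FM]]
  note LZ = linear_mapD(1)[OF L_linear_map Z]
  show "subspace F" by (rule F_sub)
  show "EF (L Z) \<in> F" using E_lin(1)[OF EF FM LZ] .
  show "0 \<in> F" using F_sub by (rule subspace_0)
  show "J A \<bullet> J (EF (L Z) - 0) = 0" if A: "A \<in> F" for A
  proof -
    have "J A \<bullet> J (L Z) = 0"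
      using LA_antisym[of A Z] LS_sym[of A Z] A Z
      by (simp add: lift_generator_def J_add J_scale inner_add_right)
    moreover have "J A \<bullet> J (L Z - EF (L Z)) = 0"
      by (rule conditional_expectation_kms_orthogonal[OF EF FM A LZ])
    ultimately show ?thesis
      by (simp add: J_diff inner_diff_right)
  qed
qed

text \<open>Subtracting \<open>EO X\<close> changes neither \<open>LA X\<close> nor the overdamped form, since \<open>EO X\<close> is a fixed
  point; and \<open>EF\<close>, which has the same range as \<open>EO\<close>, coincides with it.\<close>

lemma mean_zero_part:
  assumes X: "X \<in> N"
  shows "X - EO X \<in> N" "EF (X - EO X) = 0" "LA (X - EO X) = LA X"
    and "- (J X \<bullet> J (LO X)) = J (LA (X - EO X)) \<bullet> J (G (LA (X - EO X)))"
proof -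
  have XM: "X \<in> M"
    using X NM by blast
  have E: "EO X \<in> F"
    using E_lin(1)[OF EO FM XM] .
  have nE: "(-1) *\<^sub>R EO X \<in> M"
    using E M_real_sub by (intro subspace_scale) auto
  show "X - EO X \<in> N"
    using X E N_real_sub by (intro subspace_diff) (auto simp: ker_on_def)
  show LAX: "LA (X - EO X) = LA X"
    using LA_lin(2)[OF XM nE] LA_lin(4)[of "EO X" "-1"] E by simp
  have "EF X = EO X"
    by (rule conditional_expectation_unique[OF EF EO FM XM])
  moreover have "EF (X - EO X) = EF X - EF (EO X)"
    using E_lin(2)[OF EF FM XM nE] E_lin(4)[OF EF FM, of "EO X" "-1"] E by simp
  moreover have "EF (EO X) = EO X"
    using E_id[OF EF FM E] .
  ultimately show "EF (X - EO X) = 0"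
    by simp
  show "- (J X \<bullet> J (LO X)) = J (LA (X - EO X)) \<bullet> J (G (LA (X - EO X)))"
    using overdamped_form[OF X X] by (simp add: LAX)
qed

lemma rayleigh_quotient_bound:
  assumes K: "K \<noteq> {0}" and X: "X \<in> N" and ne: "X \<noteq> EO X"
  defines "q \<equiv> Re (- kms_ip \<sigma> X (LO X)) / (kms_norm \<sigma> (X - EO X))\<^sup>2"
  shows "s_min * (norm (J (LA (X - EO X))))\<^sup>2 \<le> q * (norm (J (X - EO X)))\<^sup>2"
proof -
  let ?Y = "X - EO X"
  have "LA ?Y \<in> K"
    using mean_zero_part(1)[OF X] K_eq by blast
  then have "s_min * (J (LA ?Y) \<bullet> J (LA ?Y)) \<le> - (J X \<bullet> J (LO X))"
    using min_eigenvalue_compression(2)[OF K, of "LA ?Y"] mean_zero_part(4)[OF X] by simp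
  moreover have "q * (norm (J ?Y))\<^sup>2 = - (J X \<bullet> J (LO X))"
    using ne by (simp add: q_def kms_norm_eq Re_kms_ip)
  ultimately show ?thesis
    by (simp add: power2_norm_eq_inner)
qed

text \<open>The drop in dimension provides an observable in \<open>N\<close> that is not a fixed point.  It keeps the
  infimum in the spectral gap and the minimum over eigenvalues from running over empty sets.\<close>

lemma range_nonzero:
  assumes "cmat.dim F < cmat.dim N"
  shows "K \<noteq> {0}" "\<exists>X\<in>N. X \<noteq> EO X"
proof -
  have FN: "F \<subseteq> N"
    by (auto simp: ker_on_def)
  have not: "\<not> N \<subseteq> F"
    using FN assms by auto
  then obtain X where X: "X \<in> N" "X \<notin> F" by blast
  then have "LA X \<noteq> 0"
    by (auto simp: ker_on_def)
  then show "K \<noteq> {0}"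
    using X(1) K_eq by blast
  have E: "EO X \<in> F"
    using E_lin(1)[OF EO FM, of X] X(1) NM by blast
  have "X \<noteq> EO X"
  proof
    assume eq: "X = EO X"
    show False
      using X(2) E unfolding eq[symmetric] by (rule notE)
  qed
  then show "\<exists>X\<in>N. X \<noteq> EO X"
    using X(1) by blast
qed

context
  fixes C \<nu> :: real
  assumes dim: "cmat.dim F < cmat.dim N" and C: "C \<ge> 1" and \<nu>: "\<nu> > 0"
    and decay: "\<And>X t. X \<in> M \<Longrightarrow> t \<ge> 0 \<Longrightarrow>
           kms_norm \<sigma> (sg_exp L t X - EF X) \<le> C * exp (- \<nu> * t) * kms_norm \<sigma> (X - EF X)"
begin

abbreviation "gap \<equiv> spectral_gap \<sigma> N LO EO"

lemma s_min_pos: "s_min > 0"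
  using min_eigenvalue_compression(1) range_nonzero(1)[OF dim] .

text \<open>The infimum in the spectral gap is approached through an inequality valid for every observable
  in \<open>N\<close>, with \<open>n\<close> its distance from the fixed points and \<open>m\<close> its speed.\<close>

lemma le_gapI:
  assumes "\<And>X n m. X \<in> N \<Longrightarrow> X \<noteq> EO X \<Longrightarrow> norm (J (X - EO X)) = n \<Longrightarrow> n > 0
    \<Longrightarrow> norm (J (LA (X - EO X))) = m \<Longrightarrow> c * n\<^sup>2 \<le> s_min * m\<^sup>2"
  shows "c \<le> gap"
  unfolding spectral_gap_def
proof (rule cInf_greatest)
  show "{Re (- kms_ip \<sigma> X (LO X)) / (kms_norm \<sigma> (X - EO X))\<^sup>2 | X. X \<in> N \<and> X \<noteq> EO X} \<noteq> {}"
    using range_nonzero(2)[OF dim] by blast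
next
  fix q assume "q \<in> {Re (- kms_ip \<sigma> X (LO X)) / (kms_norm \<sigma> (X - EO X))\<^sup>2 | X. X \<in> N \<and> X \<noteq> EO X}"
  then obtain X where X: "X \<in> N" "X \<noteq> EO X"
    and q: "q = Re (- kms_ip \<sigma> X (LO X)) / (kms_norm \<sigma> (X - EO X))\<^sup>2"
    by blast
  define n where "n = norm (J (X - EO X))"
  have n: "n > 0"
    using X(2) by (simp add: n_def)
  have "c * n\<^sup>2 \<le> q * n\<^sup>2"
    using rayleigh_quotient_bound[OF range_nonzero(1)[OF dim] X] assms[OF X n_def[symmetric] n refl]
    unfolding q n_def by linarith
  then show "c \<le> q"
    using n by simp
qed

context
  fixes T assumes T: "linear T" "\<And>X. X \<in> M \<Longrightarrow> T X = L X"
begin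

lemma sg_exp_T: "X \<in> M \<Longrightarrow> sg_exp L t X = sg_exp T t X"
  using sg_exp_cong[of M L T X t] T(2) linear_mapD(1)[OF L_linear_map] by simp

lemma T_M: "X \<in> M \<Longrightarrow> T X \<in> M"
  using T(2) linear_mapD(1)[OF L_linear_map] by simp

lemma T_contraction:
  assumes "X \<in> M" "0 \<le> t"
  shows "norm (J (sg_exp T t X)) \<le> norm (J X)"
  using dissipative_imp_contraction[OF T(1) M_real_sub T_M _ assms] L_dissipative T(2) by simp

lemma T_decay:
  assumes "X \<in> M" "EF X = 0" "0 \<le> t"
  shows "norm (J (sg_exp T t X)) \<le> C * exp (- \<nu> * t) * norm (J X)"
  using decay[OF assms(1,3)] assms(2) by (simp add: kms_norm_eq sg_exp_T[OF assms(1)])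

end

text \<open>The integral of \<open>P\<^sub>t LA Y\<close> over all times, bounded by means of the assumed decay.\<close>

lemma decay_time_bound:
  assumes Y: "Y \<in> N" "EF Y = 0"
  shows "norm (J Y) \<le> (1 + ln C) / \<nu> * norm (J (LA Y))"
proof -
  obtain T where T: "linear T" "\<And>X. X \<in> M \<Longrightarrow> T X = L X"
    using linear_map_extension[OF M_sub L_linear_map] by blast
  have YM: "Y \<in> M" using Y NM by blast
  have TY: "T Y = LA Y" "T Y = L Y"
    using T(2)[OF YM] Y(1) by (simp_all add: lift_generator_def ker_on_def)
  note TYM = T_M[OF T YM]
  have EFTY: "EF (T Y) = 0"
    unfolding TY(2) by (rule EF_lift_generator[OF YM])
  show ?thesis
    unfolding TY(1)[symmetric]
    by (rule norm_le_by_decay[OF T(1) C \<nu> T_contraction[OF T TYM] T_decay[OF T TYM EFTY] T_decay[OF T YM Y(2)]])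
qed

text \<open>Contractivity bounds the speed of \<open>P\<^sub>t Y\<close> by its initial value \<open>\<parallel>LA Y\<parallel>\<close>.\<close>

lemma short_time_bound:
  assumes Y: "Y \<in> N" and t: "0 \<le> t"
  shows "norm (J (sg_exp L t Y) - J Y) \<le> t * norm (J (LA Y))"
proof -
  obtain T where T: "linear T" "\<And>X. X \<in> M \<Longrightarrow> T X = L X"
    using linear_map_extension[OF M_sub L_linear_map] by blast
  have YM: "Y \<in> M" using Y NM by blast
  have TY: "T Y = LA Y"
    using T(2)[OF YM] Y(1) by (simp add: lift_generator_def ker_on_def)
  have "norm (J (sg_exp T t Y) - J (sg_exp T 0 Y)) \<le> t * norm (J (T Y)) - 0 * norm (J (T Y))"
  proof (rule sg_exp_increment_bound[OF T(1) t, where \<phi>' = "\<lambda>_. norm (J (T Y))"])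
    show "((\<lambda>t. t * norm (J (T Y))) has_real_derivative norm (J (T Y))) (at s)" for s
      by (auto intro!: derivative_eq_intros)
    show "norm (J (sg_exp T s (T Y))) \<le> norm (J (T Y))" if "0 < s" for s
      using T_contraction[OF T T_M[OF T YM], of s] that by simp
  qed
  then show ?thesis
    by (simp add: sg_exp_0 TY sg_exp_T[OF T YM])
qed

theorem rate_bound: "\<nu> \<le> (1 + ln C) * sqrt (inverse s_min * gap)"
proof -
  have lnC: "1 + ln C > 0"
    using C by (simp add: add_pos_nonneg)
  have "s_min * (\<nu> / (1 + ln C))\<^sup>2 \<le> gap"
  proof (rule le_gapI)
    fix X n m assume X: "X \<in> N" and n: "norm (J (X - EO X)) = n" "n > 0"
      and m: "norm (J (LA (X - EO X))) = m"
    have "n \<le> (1 + ln C) / \<nu> * m"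
      using decay_time_bound[OF mean_zero_part(1,2)[OF X]] n m by simp
    then have "\<nu> / (1 + ln C) * n \<le> m"
      using lnC \<nu> by (simp add: field_simps)
    moreover have "0 \<le> \<nu> / (1 + ln C) * n"
      using lnC \<nu> n by simp
    ultimately have "(\<nu> / (1 + ln C) * n)\<^sup>2 \<le> m\<^sup>2"
      by (rule power_mono)
    then show "s_min * (\<nu> / (1 + ln C))\<^sup>2 * n\<^sup>2 \<le> s_min * m\<^sup>2"
      using s_min_pos by (simp only: power_mult_distrib mult.assoc mult_le_cancel_left_pos)
  qed
  then have "(\<nu> / (1 + ln C))\<^sup>2 \<le> inverse s_min * gap"
    using s_min_pos by (simp add: field_simps)
  then have "\<nu> / (1 + ln C) \<le> sqrt (inverse s_min * gap)"
    by (rule real_le_rsqrt)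
  then show ?thesis
    using lnC by (simp add: field_simps)
qed

theorem relaxation_time_bound: "1 / (2 * sqrt (inverse s_min * gap)) \<le> relaxation_time \<sigma> M L EF"
  unfolding relaxation_time_def
proof (rule cInf_greatest)
  \<comment> \<open>At this time \<open>C e\<^sup>-\<^sup>\<nu>\<^sup>t = 1/e\<close>, so the infimum runs over a nonempty set.\<close>
  let ?t = "(1 + ln C) / \<nu>"
  have t: "?t \<ge> 0"
    using C \<nu> by simp
  have "- \<nu> * ?t = - 1 + - ln C"
    using \<nu> by simp
  moreover have "C * exp (- 1 + - ln C) = exp (- 1)"
    using C unfolding exp_add by (simp add: exp_minus)
  ultimately have e: "C * exp (- \<nu> * ?t) = exp (- 1)"
    by simp
  have "kms_norm \<sigma> (sg_exp L ?t X) \<le> exp (- 1) * kms_norm \<sigma> X" if "X \<in> M" "EF X = 0" for X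
    using decay[OF that(1) t] that(2) e by simp
  then show "{t. t \<ge> 0 \<and> (\<forall>X\<in>M. EF X = 0 \<longrightarrow> kms_norm \<sigma> (sg_exp L t X) \<le> exp (- 1) * kms_norm \<sigma> X)} \<noteq> {}"
    using t by blast
next
  fix t assume "t \<in> {t. t \<ge> 0 \<and> (\<forall>X\<in>M. EF X = 0 \<longrightarrow> kms_norm \<sigma> (sg_exp L t X) \<le> exp (- 1) * kms_norm \<sigma> X)}"
  then have t: "t \<ge> 0"
    and tr: "\<And>X. X \<in> M \<Longrightarrow> EF X = 0 \<Longrightarrow> norm (J (sg_exp L t X)) \<le> exp (- 1) * norm (J X)"
    by (auto simp: kms_norm_eq)
  have "(2::real) \<le> exp 1"
    using exp_ge_add_one_self[of 1] by simp
  then have half: "exp (- 1) \<le> (1 / 2 :: real)"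
    by (simp add: exp_minus field_simps)
  have *: "n / 2 \<le> t * m" if X: "X \<in> N" and n: "norm (J (X - EO X)) = n" and m: "norm (J (LA (X - EO X))) = m" for X n m
  proof -
    let ?Y = "X - EO X"
    note Y = mean_zero_part(1,2)[OF X]
    have "n \<le> norm (J (sg_exp L t ?Y) - J ?Y) + norm (J (sg_exp L t ?Y))"
      unfolding n[symmetric] by (metis norm_minus_commute norm_triangle_sub add.commute)
    also have "\<dots> \<le> t * m + exp (- 1) * n"
      using short_time_bound[OF Y(1) t] tr[OF subsetD[OF NM Y(1)] Y(2)] n m by simp
    also have "\<dots> \<le> t * m + 1 / 2 * n"
      using half n by (intro add_left_mono mult_right_mono) auto
    finally show ?thesis
      by simp
  qed
  have t_pos: "t > 0"
  proof -
    obtain X where X: "X \<in> N" "X \<noteq> EO X"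
      using range_nonzero(2)[OF dim] by blast
    then have "norm (J (X - EO X)) > 0"
      by simp
    then show ?thesis
      using *[OF X(1) refl refl] t by (cases "t = 0") auto
  qed
  have "s_min * (1 / (2 * t))\<^sup>2 \<le> gap"
  proof (rule le_gapI)
    fix X n m assume X: "X \<in> N" and n: "norm (J (X - EO X)) = n" "n > 0"
      and m: "norm (J (LA (X - EO X))) = m"
    have "1 / (2 * t) * n \<le> m"
      using *[OF X n(1) m] t_pos by (simp add: field_simps)
    then have "(1 / (2 * t) * n)\<^sup>2 \<le> m\<^sup>2"
      using n t_pos by (intro power_mono) auto
    then show "s_min * (1 / (2 * t))\<^sup>2 * n\<^sup>2 \<le> s_min * m\<^sup>2"
      using s_min_pos by (simp only: power_mult_distrib mult.assoc mult_le_cancel_left_pos)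
  qed
  then have "(1 / (2 * t))\<^sup>2 \<le> inverse s_min * gap"
    using s_min_pos by (simp add: field_simps)
  then have le: "1 / (2 * t) \<le> sqrt (inverse s_min * gap)"
    by (rule real_le_rsqrt)
  moreover have "0 < 1 / (2 * t)"
    using t_pos by simp
  ultimately have "0 < sqrt (inverse s_min * gap)"
    by linarith
  then show "1 / (2 * sqrt (inverse s_min * gap)) \<le> t"
    using le t_pos by (simp add: pos_divide_le_eq mult_ac)
qed

end

end

end

theorem theorem2p16:
  fixes M :: "(complex ^ 'n::finite ^ 'n) set"
    and \<sigma> :: "complex ^ 'n ^ 'n"
    and LA LS ES EF EO :: "complex ^ 'n ^ 'n \<Rightarrow> complex ^ 'n ^ 'n"
    and \<gamma> C \<nu> :: real
  assumes "von_neumann_algebra M"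
    and "second_order_lift \<sigma> M LA LS ES"
    and "\<gamma> > 0"
    and "conditional_expectation \<sigma> M (ker_on M (lift_generator LA LS \<gamma>)) EF"
    and "conditional_expectation \<sigma> M
           (ker_on (ker_on M LS) (overdamped_generator \<sigma> M LA LS ES)) EO"
    and "C \<ge> 1" and "\<nu> > 0"
    and "\<And>X t. X \<in> M \<Longrightarrow> t \<ge> 0 \<Longrightarrow>
           kms_norm \<sigma> (sg_exp (lift_generator LA LS \<gamma>) t X - EF X)
             \<le> C * exp (- \<nu> * t) * kms_norm \<sigma> (X - EF X)"
  shows "\<nu> \<le> (1 + ln C) * sqrt (inverse (min_eigenvalue_compression \<sigma> M LA LS ES)
             * spectral_gap \<sigma> (ker_on M LS) (overdamped_generator \<sigma> M LA LS ES) EO)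
    \<and> relaxation_time \<sigma> M (lift_generator LA LS \<gamma>) EF
        \<ge> 1 / (2 * sqrt (inverse (min_eigenvalue_compression \<sigma> M LA LS ES)
             * spectral_gap \<sigma> (ker_on M LS) (overdamped_generator \<sigma> M LA LS ES) EO))"
proof -
  have lift: "linear_map M M LA" "linear_map M M LS"
    "\<And>\<gamma>. \<gamma> > 0 \<Longrightarrow> qms_generator M (lift_generator LA LS \<gamma>)"
    "conditional_expectation \<sigma> M (ker_on M LS) ES" "\<sigma> \<in> full_rank_states M"
    "\<And>X. X \<in> M \<Longrightarrow> LS X = kms_adjoint \<sigma> M LS X" "\<And>X. X \<in> M \<Longrightarrow> LA X = - kms_adjoint \<sigma> M LA X"
    "\<And>\<gamma>. \<gamma> > 0 \<Longrightarrow> cmat.dim (ker_on M (lift_generator LA LS \<gamma>)) < cmat.dim (ker_on M LS)"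
    "\<And>X. X \<in> M \<Longrightarrow> ES (LA (ES X)) = 0"
    using assms(2) unfolding second_order_lift_def Let_def by blast+
  interpret faithful_vna \<sigma> M
    using assms(1) lift(5) by unfold_locales (auto simp: full_rank_states_def)
  interpret hypocoercive_pair \<sigma> M LA LS ES
  proof
    show "J (LA X) \<bullet> J Y = - (J X \<bullet> J (LA Y))" if "X \<in> M" "Y \<in> M" for X Y
      using kms_adjoint(2)[OF M_sub lift(1) that(1), of Y] arg_cong[OF lift(7)[OF that(2)], of J]
      by (simp add: linear_neg[OF linear_J])
    show "J (LS X) \<bullet> J Y = J X \<bullet> J (LS Y)" if "X \<in> M" "Y \<in> M" for X Y
      using kms_adjoint(2)[OF M_sub lift(2) that(1), of Y] lift(6)[OF that(2)] by simp
  qed (use lift in auto)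
  note EF = assms(4)[unfolded ker_lift_generator[OF assms(3)]]
  note EO = assms(5)[unfolded ker_overdamped]
  note dim = lift(8)[OF assms(3), unfolded ker_lift_generator[OF assms(3)]]
  show ?thesis
    using rate_bound[OF assms(3) EF EO dim assms(6-8)] relaxation_time_bound[OF assms(3) EF EO dim assms(6-8)]
    by blast
qed

end
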